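(* Let $\delta>0$, let $\Omega,\Omega'$ be compact sets in $\mathbb{R}$, and let $\mu\in\mathcal{P}(\Omega)$ and $\nu\in\mathcal{P}(\Omega')$ be probability measures with $\operatorname{Supp}(\mu)=\Omega$ and $\operatorname{Supp}(\nu)=\Omega'$. If $\mu$ has no atom, then there exists an optimal transport map for the cost $\omega_\delta$, i.e. there exists $T\in\mathrm{T}(\mu,\nu)$ such that $\omega_\delta(T)\le\omega_\delta(S)$ for all $S\in\mathrm{T}(\mu,\nu)$, where $$\omega_\delta(T):=\sup_{x,x'\in\Omega,\ |x-x'|<\delta}|T(x)-T(x')|.$$
   Context: $\mathrm{T}(\mu,\nu)$ is the set of transport maps from $\mu$ to $\nu$: all Borel maps $T:\Omega\to\Omega'$ (defined at every point of $\Omega$) such that $T_\#\mu=\nu$, where $T_\#\mu(A)=\mu(T^{-1}(A))$. *)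

theory Defs
  imports "HOL-Probability.Probability"
begin

definition prob_measures_on :: "'a::topological_space set \<Rightarrow> 'a measure set" where
  "prob_measures_on \<Omega> = {M. prob_space M \<and> sets M = sets (restrict_space borel \<Omega>)}"

text \<open>Neighbourhoods are taken relative to the space of the measure, so the support is
  defined both for measures on the whole type and for measures living on a subspace.\<close>

definition measure_support :: "'a::topological_space measure \<Rightarrow> 'a set" where
  "measure_support M =
     {x \<in> space M. \<forall>U. open U \<and> x \<in> U \<longrightarrow> emeasure M (U \<inter> space M) > 0}"

definition no_atom :: "'a measure \<Rightarrow> bool" where
  "no_atom M \<longleftrightarrow> (\<forall>x \<in> space M. emeasure M {x} = 0)"

text \<open>Measurability includes that \<open>T\<close> maps every point of \<open>space M\<close> into \<open>space N\<close>.
  Values of \<open>T\<close> outside \<open>space M\<close> are unconstrained and play no role.\<close>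

definition transport_maps :: "'a measure \<Rightarrow> 'b measure \<Rightarrow> ('a \<Rightarrow> 'b) set" where
  "transport_maps M N = {T \<in> measurable M N. distr M N T = N}"

text \<open>The supremum is taken in the reals; it is a genuine supremum whenever \<open>\<Omega>\<close> is
  nonempty, \<open>\<delta>\<close> is positive and \<open>T\<close> is bounded on \<open>\<Omega>\<close>. The two lemmas below show that
  this is the case for transport maps into a bounded set.\<close>

definition modulus_cost :: "real set \<Rightarrow> real \<Rightarrow> (real \<Rightarrow> real) \<Rightarrow> real" where
  "modulus_cost \<Omega> \<delta> T =
     Sup {\<bar>T x - T x'\<bar> | x x'. x \<in> \<Omega> \<and> x' \<in> \<Omega> \<and> \<bar>x - x'\<bar> < \<delta>}"

lemma modulus_cost_set_nonempty:
  fixes T :: "real \<Rightarrow> real"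
  assumes "\<mu> \<in> prob_measures_on \<Omega>" and "\<delta> > 0"
  shows "{\<bar>T x - T x'\<bar> | x x'. x \<in> \<Omega> \<and> x' \<in> \<Omega> \<and> \<bar>x - x'\<bar> < \<delta>} \<noteq> {}"
proof -
  have "prob_space \<mu>" and "space \<mu> = \<Omega>"
    using assms(1) sets_eq_imp_space_eq[of \<mu> "restrict_space borel \<Omega>"]
    by (auto simp: prob_measures_on_def space_restrict_space)
  then obtain x where "x \<in> \<Omega>"
    using prob_space.not_empty by blast
  moreover have "\<bar>x - x\<bar> < \<delta>"
    using assms(2) by simp
  ultimately show ?thesis
    by blast
qed

lemma modulus_cost_set_bdd_above:
  fixes T :: "real \<Rightarrow> real"
  assumes "\<mu> \<in> prob_measures_on \<Omega>" and "\<nu> \<in> prob_measures_on \<Omega>'" and "bounded \<Omega>'"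
    and "T \<in> transport_maps \<mu> \<nu>"
  shows "bdd_above {\<bar>T x - T x'\<bar> | x x'. x \<in> \<Omega> \<and> x' \<in> \<Omega> \<and> \<bar>x - x'\<bar> < \<delta>}"
proof -
  have "space \<mu> = \<Omega>" and "space \<nu> = \<Omega>'"
    using assms(1,2) sets_eq_imp_space_eq[of \<mu> "restrict_space borel \<Omega>"]
      sets_eq_imp_space_eq[of \<nu> "restrict_space borel \<Omega>'"]
    by (auto simp: prob_measures_on_def space_restrict_space)
  then have T: "T x \<in> \<Omega>'" if "x \<in> \<Omega>" for x
    using assms(4) that by (auto simp: transport_maps_def dest: measurable_space)
  obtain B where B: "\<And>y. y \<in> \<Omega>' \<Longrightarrow> \<bar>y\<bar> \<le> B"
    using assms(3) by (auto simp: bounded_iff)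
  have "\<bar>T x - T x'\<bar> \<le> 2 * B" if "x \<in> \<Omega>" "x' \<in> \<Omega>" for x x'
    using B[OF T[OF that(1)]] B[OF T[OF that(2)]] by linarith
  then show ?thesis
    by (intro bdd_aboveI[where M = "2 * B"]) auto
qed

end

theory Submission
  imports Defs
begin

text \<open>
  Cut \<open>\<Omega>\<close> into finitely many clusters \<open>J\<^sub>k = \<Omega> \<inter> [k\<delta>, (k+1)\<delta>)\<close>. Along a subsequence of a
  minimizing sequence \<open>T\<^sub>n\<close>, the suprema and infima over all rational windows and the distribution
  functions of \<open>T\<^sub>n\<close> on each cluster converge at rationals. The limits are envelopes \<open>l \<le> h\<close> with
  \<open>h x - l x' \<le> L\<close> whenever \<open>\<bar>x - x'\<bar> < \<delta>\<close>, and functions \<open>G\<^sub>k\<close> adding up to the distribution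
  function of \<open>\<nu>\<close>, each compatible with \<open>l\<close> and \<open>h\<close> on its cluster.

  The envelopes are then replaced by a genuine map, one cluster at a time. On a cluster, the
  constraint imposed by the rest of \<open>\<Omega>\<close> has the form \<open>P \<le> T \<le> Q\<close>. The points to the right of the
  cluster contribute an increasing lower bound and a decreasing upper bound; but these points, and
  likewise the cluster itself, have oscillation at most \<open>L\<close>, so only one of the two bounds is active.
  The same holds on the left with directions reversed. In each of the four cases \<open>P\<close> and \<open>Q\<close> are both
  nondecreasing functions of a single rank \<open>r\<close> (one of \<open>x\<close>, \<open>-x\<close>, \<open>P\<close>, \<open>Q\<close>). Since \<open>\<mu>\<close> has no atoms,
  there is a map with distribution function \<open>G\<^sub>k\<close> that is nondecreasing along \<open>r\<close>, and it respects
  both bounds.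
\<close>

section \<open>Subsequences, measurability and quantiles\<close>

text \<open>Tychonoff replaces a diagonal argument: a power of \<open>{-B..B}\<close> over a
  countable index type is compact and first countable, hence sequentially compact, and evaluation at
  a coordinate is continuous.\<close>

lemma countable_family_convergent_subseq:
  fixes f :: "nat \<Rightarrow> 'i::countable \<Rightarrow> real"
  assumes "\<And>n i. \<bar>f n i\<bar> \<le> B"
  obtains r where "strict_mono r" "\<And>i. convergent (\<lambda>n. f (r n) i)"
proof -
  let ?K = "PiE UNIV (\<lambda>_. {-B..B}) :: ('i \<Rightarrow> real) set"
  have "compactin (product_topology (\<lambda>_. euclidean) UNIV) ?K"
    by (subst compactin_PiE) auto
  then have "compact ?K"
    by (simp add: euclidean_product_topology)
  then have "seq_compact ?K"
    by (rule compact_imp_seq_compact)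
  moreover have "\<forall>n. f n \<in> ?K"
    using assms by (auto simp: abs_le_iff minus_le_iff)
  ultimately obtain l r where r: "strict_mono r" "(f \<circ> r) \<longlonglongrightarrow> l"
    unfolding seq_compact_def by blast
  have "(\<lambda>n. f (r n) i) \<longlonglongrightarrow> l i" for i
  proof -
    have "continuous_on UNIV (\<lambda>x::'i \<Rightarrow> real. x i)"
      by (rule continuous_on_product_coordinates)
    then have "isCont (\<lambda>x::'i \<Rightarrow> real. x i) l"
      by (metis UNIV_I continuous_on_eq_continuous_at open_UNIV)
    from isCont_tendsto_compose[OF this r(2)] show ?thesis
      by (simp add: o_def)
  qed
  with r(1) that show ?thesis
    by (auto simp: convergent_def)
qed

lemma sets_Collect_subset:
  assumes "J \<in> sets M" "Measurable.pred M P"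
  shows "{x \<in> J. P x} \<in> sets M"
proof -
  have "{x \<in> J. P x} = J \<inter> {x \<in> space M. P x}"
    using sets.sets_into_space[OF assms(1)] by auto
  then show ?thesis
    using assms by auto
qed

lemma measurable_ident_restrict:
  fixes A :: "real set"
  assumes "sets N = sets (restrict_space borel A)"
  shows "(\<lambda>x. x) \<in> borel_measurable N"
proof -
  have "(\<lambda>x. x) \<in> borel_measurable (restrict_space borel A)"
    by (simp add: measurable_restrict_space1)
  then show ?thesis
    using measurable_cong_sets[OF assms refl] by blast
qed

text \<open>A generalized inverse of the distribution function of \<open>f\<close> on
  \<open>J\<close>: \<open>s\<close> is the infimum of the levels whose sublevel sets have mass at
  least \<open>u\<close>. The two masses can differ by that of the level set
  \<open>f x = s\<close>.\<close>

lemma (in finite_measure) exists_quantile: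
  fixes f :: "'a \<Rightarrow> real"
  assumes J: "J \<in> sets M" and f[measurable]: "f \<in> borel_measurable M"
    and C: "\<And>x. x \<in> J \<Longrightarrow> \<bar>f x\<bar> \<le> C" and u: "0 \<le> u" "u \<le> measure M J"
  obtains s where "measure M {x \<in> J. f x < s} \<le> u" "u \<le> measure M {x \<in> J. f x \<le> s}"
proof (cases "u = 0")
  case True
  \<comment> \<open>For \<open>u = 0\<close> every level qualifies and there is no infimum; a level
    with no point of \<open>J\<close> strictly below it serves instead.\<close>
  have empty: "{x \<in> J. f x < - C} = {}"
    using C by (force simp: abs_le_iff)
  show ?thesis
    by (rule that[of "- C"]) (simp_all only: empty True measure_empty measure_nonneg order_refl)
next
  case False
  define A where "A = {s. u \<le> measure M {x \<in> J. f x \<le> s}}"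
  have S: "{x \<in> J. f x \<le> s} \<in> sets M" for s
    by (rule sets_Collect_subset[OF J]) measurable
  have "{x \<in> J. f x \<le> C} = J"
    using C by (force simp: abs_le_iff)
  then have "C \<in> A"
    using u by (simp add: A_def)
  have bdd: "bdd_below A"
  proof (rule bdd_belowI)
    fix s assume "s \<in> A"
    show "- C \<le> s"
    proof (rule ccontr)
      assume "\<not> - C \<le> s"
      then have "{x \<in> J. f x \<le> s} = {}"
        using C by (force simp: abs_le_iff)
      with \<open>s \<in> A\<close> False u(1) show False
        by (simp add: A_def)
    qed
  qed
  define s where "s = Inf A"
  \<comment> \<open>Levels above \<open>s\<close> dominate a member of \<open>A\<close>; by
    continuity from above, the infimum is attained.\<close>
  have "(\<lambda>n. measure M {x \<in> J. f x \<le> s + inverse (real (Suc n))}) \<longlonglongrightarrow>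
      measure M (\<Inter>n. {x \<in> J. f x \<le> s + inverse (real (Suc n))})"
    by (intro finite_Lim_measure_decseq)
       (use S in \<open>auto simp: decseq_def intro: order_trans le_imp_inverse_le\<close>)
  moreover have "(\<Inter>n. {x \<in> J. f x \<le> s + inverse (real (Suc n))}) = {x \<in> J. f x \<le> s}"
  proof (intro equalityI subsetI)
    fix x assume x: "x \<in> (\<Inter>n. {x \<in> J. f x \<le> s + inverse (real (Suc n))})"
    have "f x \<le> s + 0"
      by (rule LIMSEQ_le_const[OF tendsto_add[OF tendsto_const LIMSEQ_inverse_real_of_nat]])
         (use x in auto)
    with x show "x \<in> {x \<in> J. f x \<le> s}"
      by auto
  next
    fix x assume "x \<in> {x \<in> J. f x \<le> s}"
    then show "x \<in> (\<Inter>n. {x \<in> J. f x \<le> s + inverse (real (Suc n))})"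
      by (auto intro: add_increasing2)
  qed
  moreover have "u \<le> measure M {x \<in> J. f x \<le> s + inverse (real (Suc n))}" for n
  proof -
    have "Inf A < s + inverse (real (Suc n))"
      by (simp add: s_def)
    then obtain s' where "s' \<in> A" "s' < s + inverse (real (Suc n))"
      using cInf_lessD[of A] \<open>C \<in> A\<close> by blast
    then have "u \<le> measure M {x \<in> J. f x \<le> s'}"
      by (simp add: A_def)
    also have "\<dots> \<le> measure M {x \<in> J. f x \<le> s + inverse (real (Suc n))}"
      using \<open>s' < _\<close> S by (intro finite_measure_mono) auto
    finally show ?thesis .
  qed
  ultimately have up: "u \<le> measure M {x \<in> J. f x \<le> s}"
    by (intro LIMSEQ_le_const[of _ _ u]) auto
  \<comment> \<open>Levels below \<open>s\<close> are outside \<open>A\<close>, and their sublevel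
    sets exhaust the strict one.\<close>
  have "(\<lambda>n. measure M {x \<in> J. f x \<le> s - inverse (real (Suc n))}) \<longlonglongrightarrow>
      measure M (\<Union>n. {x \<in> J. f x \<le> s - inverse (real (Suc n))})"
    by (intro finite_Lim_measure_incseq)
       (use S in \<open>auto simp: incseq_def intro: order_trans le_imp_inverse_le diff_left_mono\<close>)
  moreover have "(\<Union>n. {x \<in> J. f x \<le> s - inverse (real (Suc n))}) = {x \<in> J. f x < s}"
  proof (intro equalityI subsetI)
    fix x assume "x \<in> (\<Union>n. {x \<in> J. f x \<le> s - inverse (real (Suc n))})"
    then obtain n where "x \<in> J" "f x \<le> s - inverse (real (Suc n))"
      by auto
    moreover have "inverse (real (Suc n)) > 0"
      by simp
    ultimately have "f x < s"
      by linarith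
    with \<open>x \<in> J\<close> show "x \<in> {x \<in> J. f x < s}"
      by simp
  next
    fix x assume x: "x \<in> {x \<in> J. f x < s}"
    then obtain n where "inverse (real (Suc n)) < s - f x"
      using reals_Archimedean[of "s - f x"] by auto
    then show "x \<in> (\<Union>n. {x \<in> J. f x \<le> s - inverse (real (Suc n))})"
      using x by (auto intro!: exI[of _ n])
  qed
  moreover have "measure M {x \<in> J. f x \<le> s - inverse (real (Suc n))} \<le> u" for n
  proof (rule ccontr)
    assume "\<not> ?thesis"
    then have "s - inverse (real (Suc n)) \<in> A"
      by (simp add: A_def)
    then have "s \<le> s - inverse (real (Suc n))"
      unfolding s_def using bdd by (rule cInf_lower)
    then show False
      by (simp add: field_simps)
  qed
  ultimately have "measure M {x \<in> J. f x < s} \<le> u"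
    by (intro LIMSEQ_le_const2[of _ _ u]) auto
  with up that show ?thesis
    by blast
qed

section \<open>Initial segments of prescribed mass\<close>

text \<open>Ties of the rank \<open>r\<close> are broken by position, so that an atomless measure has initial segments of
  every mass even when \<open>r\<close> is constant on a set of positive measure.\<close>

definition lex_initial :: "(real \<Rightarrow> real) \<Rightarrow> real set \<Rightarrow> real set \<Rightarrow> bool" where
  "lex_initial r J S \<longleftrightarrow> S \<subseteq> J \<and>
     (\<forall>x\<in>S. \<forall>y\<in>J. r y < r x \<or> (r y = r x \<and> y \<le> x) \<longrightarrow> y \<in> S)"

text \<open>The lexicographic order on the pairs \<open>(r x, x)\<close> is linear, and initial
  segments of a linear order form a chain.\<close>

lemma lex_initial_nested:
  assumes "lex_initial r J S" "lex_initial r J S'"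
  shows "S \<subseteq> S' \<or> S' \<subseteq> S"
proof (rule ccontr)
  assume "\<not> ?thesis"
  then obtain x y where "x \<in> S" "x \<notin> S'" "y \<in> S'" "y \<notin> S"
    by blast
  moreover have "r y < r x \<or> r y = r x \<and> y \<le> x \<or> r x < r y \<or> r x = r y \<and> x \<le> y"
    by linarith
  ultimately show False
    using assms unfolding lex_initial_def by blast
qed

text \<open>Meant for sublevel sets of functions that are nondecreasing along \<open>r\<close>: they
  contain each tie of \<open>r\<close> entirely or not at all, so position does not matter.\<close>

lemma lex_initial_lower:
  assumes "E \<subseteq> J" "\<And>x y. x \<in> E \<Longrightarrow> y \<in> J \<Longrightarrow> r y \<le> r x \<Longrightarrow> y \<in> E"
  shows "lex_initial r J E"
  using assms unfolding lex_initial_def by (metis order.order_iff_strict)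

locale atomless_on_line = prob_space M for M :: "real measure" +
  fixes \<Omega> :: "real set"
  assumes sets_eq: "sets M = sets (restrict_space borel \<Omega>)"
    and bounded_\<Omega>: "bounded \<Omega>"
    and atomless: "no_atom M"
begin

lemma space_eq: "space M = \<Omega>"
  using sets_eq_imp_space_eq[OF sets_eq] by (simp add: space_restrict_space)

lemma borel_measurableI:
  "f \<in> borel_measurable (restrict_space borel \<Omega>) \<Longrightarrow> f \<in> borel_measurable M"
  using measurable_cong_sets[OF sets_eq refl] by blast

lemma measurable_ident_real[measurable]: "(\<lambda>x. x) \<in> borel_measurable M"
  by (rule measurable_ident_restrict[OF sets_eq])

lemma measure_singleton: "x \<in> \<Omega> \<Longrightarrow> measure M {x} = 0"
  using atomless by (auto simp: no_atom_def space_eq measure_def)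

text \<open>If the inclusion fails, nesting gives \<open>S' \<subseteq> S\<close>, and the masses
  leave nothing for \<open>S - S'\<close>.\<close>

lemma AE_subset_lex_initial:
  assumes "S \<in> sets M" "S' \<in> sets M" "lex_initial r J S" "lex_initial r J S'"
    and "measure M S \<le> measure M S'"
  shows "AE x in M. x \<in> S \<longrightarrow> x \<in> S'"
proof (cases "S \<subseteq> S'")
  case True
  then show ?thesis by auto
next
  case False
  then have sub: "S' \<subseteq> S"
    using lex_initial_nested[OF assms(3,4)] by blast
  have "measure M (S - S') = measure M S - measure M S'"
    using assms sub by (intro finite_measure_Diff) auto
  then have "measure M (S - S') = 0"
    using assms(5) measure_nonneg[of M "S - S'"] by linarith
  then have "S - S' \<in> null_sets M"
    using assms(1,2) by (auto simp: null_sets_def emeasure_eq_measure)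
  then show ?thesis
    by (rule AE_I') auto
qed

text \<open>Take everything strictly below a quantile \<open>s\<close> of \<open>r\<close>, then
  fill up the missing mass from the tie \<open>r x = s\<close>, from left to right up to a quantile
  \<open>c\<close> of the position. The mass is exact because \<open>{c}\<close> is null.\<close>

lemma exists_lex_initial:
  assumes J: "J \<in> sets M" and r[measurable]: "r \<in> borel_measurable M"
    and C: "\<And>x. x \<in> J \<Longrightarrow> \<bar>r x\<bar> \<le> C" and u: "0 \<le> u" "u \<le> measure M J"
  shows "\<exists>S. S \<in> sets M \<and> lex_initial r J S \<and> measure M S = u"
proof -
  obtain s where s: "measure M {x \<in> J. r x < s} \<le> u" "u \<le> measure M {x \<in> J. r x \<le> s}"
    using exists_quantile[OF J r C u] by blast
  define L where "L = {x \<in> J. r x < s}"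
  define E where "E = {x \<in> J. r x = s}"
  have L: "L \<in> sets M" and E: "E \<in> sets M"
    unfolding L_def E_def by (intro sets_Collect_subset[OF J]; measurable)+
  have "{x \<in> J. r x \<le> s} = L \<union> E" "L \<inter> E = {}"
    by (auto simp: L_def E_def)
  then have mLE: "u - measure M L \<le> measure M E" "0 \<le> u - measure M L"
    using s finite_measure_Union[OF L E] by (auto simp: L_def)
  have J\<Omega>: "J \<subseteq> \<Omega>"
    using sets.sets_into_space[OF J] by (simp add: space_eq)
  obtain D where D: "\<And>x. x \<in> \<Omega> \<Longrightarrow> \<bar>x\<bar> \<le> D"
    using bounded_\<Omega> by (auto simp: bounded_iff)
  have "\<bar>x\<bar> \<le> D" if "x \<in> E" for x
    using that J\<Omega> D by (auto simp: E_def)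
  from exists_quantile[OF E measurable_ident_real this mLE(2,1)] obtain c where
    c: "measure M {x \<in> E. x < c} \<le> u - measure M L" "u - measure M L \<le> measure M {x \<in> E. x \<le> c}"
    by blast
  have Ec: "{x \<in> E. x < c} \<in> sets M" "{x \<in> E. x \<le> c} \<in> sets M" "E \<inter> {c} \<in> sets M"
    subgoal by (rule sets_Collect_subset[OF E]) measurable
    subgoal by (rule sets_Collect_subset[OF E]) measurable
    subgoal using sets_Collect_subset[OF E, of "\<lambda>x. x = c"] by (simp add: Collect_conj_eq)
    done
  have "measure M (E \<inter> {c}) = 0"
    using J\<Omega> measure_singleton[of c] by (cases "c \<in> E") (auto simp: E_def)
  moreover have "{x \<in> E. x \<le> c} = {x \<in> E. x < c} \<union> E \<inter> {c}"
    by auto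
  ultimately have "measure M {x \<in> E. x \<le> c} \<le> measure M {x \<in> E. x < c}"
    using measure_Un_le[OF Ec(1,3)] by simp
  then have "measure M {x \<in> E. x \<le> c} = u - measure M L"
    using c by linarith
  then have "measure M (L \<union> {x \<in> E. x \<le> c}) = u"
    using L Ec \<open>L \<inter> E = {}\<close> by (subst finite_measure_Union) auto
  moreover have "lex_initial r J (L \<union> {x \<in> E. x \<le> c})"
    by (auto simp: lex_initial_def L_def E_def)
  ultimately show ?thesis
    using L Ec by blast
qed

text \<open>A quantile transform along \<open>r\<close>: nested initial segments \<open>A q\<close>
  of mass \<open>G q\<close> act as approximate sublevel sets of \<open>T\<close>. The last two
  conclusions express monotonicity along \<open>r\<close>: an arbitrary initial segment is compared
  with the sublevel sets of \<open>T\<close> by mass alone.\<close>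

lemma rearrangement:
  fixes G :: "real \<Rightarrow> real" and a b :: real
  assumes J: "J \<in> sets M" and r[measurable]: "r \<in> borel_measurable M"
    and C: "\<And>x. x \<in> J \<Longrightarrow> \<bar>r x\<bar> \<le> C"
    and G_mono: "\<And>q q'. q \<in> \<rat> \<Longrightarrow> q' \<in> \<rat> \<Longrightarrow> q \<le> q' \<Longrightarrow> G q \<le> G q'"
    and G_range: "\<And>q. q \<in> \<rat> \<Longrightarrow> 0 \<le> G q \<and> G q \<le> measure M J"
    and G_low: "\<And>q. q \<in> \<rat> \<Longrightarrow> q < a \<Longrightarrow> G q = 0"
    and G_high: "\<And>q. q \<in> \<rat> \<Longrightarrow> q \<ge> b \<Longrightarrow> G q = measure M J"
    and "a \<le> b"
  shows "\<exists>T \<in> borel_measurable M. \<forall>q\<in>\<rat>.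
    G q \<le> measure M {x \<in> J. T x \<le> q} \<and> measure M {x \<in> J. T x < q} \<le> G q \<and>
    (\<forall>E\<in>sets M. lex_initial r J E \<longrightarrow>
      (G q \<le> measure M E \<longrightarrow> (AE x in M. x \<in> J \<longrightarrow> T x < q \<longrightarrow> x \<in> E)) \<and>
      (measure M E \<le> G q \<longrightarrow> (AE x in M. x \<in> E \<longrightarrow> T x \<le> q)))"
proof -
  have "\<forall>u\<in>{0..measure M J}. \<exists>S. S \<in> sets M \<and> lex_initial r J S \<and> measure M S = u"
    using exists_lex_initial[OF J r C] by auto
  then obtain S where S: "\<And>u. u \<in> {0..measure M J} \<Longrightarrow>
      S u \<in> sets M \<and> lex_initial r J (S u) \<and> measure M (S u) = u"
    by metis
  \<comment> \<open>The segment is a function of the mass, so equal values of \<open>G\<close> give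
    equal sets; this makes \<open>A\<close> monotone everywhere and not just up to null
    sets.\<close>
  define A where "A q = S (G q)" for q
  have A: "A q \<in> sets M" "lex_initial r J (A q)" "measure M (A q) = G q" if "q \<in> \<rat>" for q
    using S[of "G q"] G_range[OF that] by (auto simp: A_def)
  have A_mono: "A q \<subseteq> A q'" if "q \<in> \<rat>" "q' \<in> \<rat>" "q \<le> q'" for q q'
  proof (cases "G q = G q'")
    case True
    then show ?thesis by (simp add: A_def)
  next
    case False
    show ?thesis
    proof (rule ccontr)
      assume "\<not> A q \<subseteq> A q'"
      then have "A q' \<subseteq> A q"
        using lex_initial_nested[OF A(2) A(2)] that by blast
      then have "measure M (A q') \<le> measure M (A q)"
        using A that by (intro finite_measure_mono) auto
      with A(3) that G_mono[OF that] False show False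
        by auto
    qed
  qed
  have AJ: "A q \<subseteq> J" if "q \<in> \<rat>" for q
    using A(2)[OF that] by (simp add: lex_initial_def)
  \<comment> \<open>Inserting \<open>b\<close> makes the set nonempty and \<open>a \<le> q\<close>
    bounds it below, so \<open>a \<le> T x \<le> b\<close> even for points outside all
    \<open>A q\<close>.\<close>
  define T where "T x = Inf (insert b {q \<in> \<rat>. a \<le> q \<and> x \<in> A q})" for x
  have bdd: "bdd_below (insert b {q \<in> \<rat>. a \<le> q \<and> x \<in> A q})" for x
    using \<open>a \<le> b\<close> by (intro bdd_belowI[of _ a]) auto
  have T_ge: "a \<le> T x" for x
    unfolding T_def using \<open>a \<le> b\<close> by (intro cInf_greatest) auto
  have T_le: "T x \<le> q" if "x \<in> A q" "q \<in> \<rat>" "a \<le> q" for x q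
    unfolding T_def using bdd that by (intro cInf_lower) auto
  have T_le_b: "T x \<le> b" for x
    unfolding T_def using bdd by (intro cInf_lower) auto
  have T_less: "\<exists>q'\<in>\<rat>. a \<le> q' \<and> q' < q \<and> x \<in> A q'" if "T x < q" "q \<le> b" for x q
  proof -
    obtain z where "z \<in> insert b {q \<in> \<rat>. a \<le> q \<and> x \<in> A q}" "z < q"
      using cInf_lessD[of "insert b {q \<in> \<rat>. a \<le> q \<and> x \<in> A q}" q] \<open>T x < q\<close>
      by (auto simp: T_def)
    with \<open>q \<le> b\<close> show ?thesis
      by auto
  qed
  have T_less_A: "x \<in> A q" if "T x < q" "q \<le> b" "q \<in> \<rat>" for x q
    using T_less[OF that(1,2)] A_mono[of _ q] that(3) by (meson in_mono less_imp_le)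
  have T_meas: "T \<in> borel_measurable M"
  proof (subst borel_measurable_iff_less, rule allI)
    fix t
    show "{x \<in> space M. T x < t} \<in> sets M"
    proof (cases "t \<le> b")
      case True
      have "{x \<in> space M. T x < t} = (\<Union>q\<in>\<rat> \<inter> {a..<t}. A q)"
      proof (intro equalityI subsetI)
        fix x assume "x \<in> {x \<in> space M. T x < t}"
        then show "x \<in> (\<Union>q\<in>\<rat> \<inter> {a..<t}. A q)"
          using T_less[of x t] True by auto
      next
        fix x assume "x \<in> (\<Union>q\<in>\<rat> \<inter> {a..<t}. A q)"
        then obtain q where "q \<in> \<rat>" "a \<le> q" "q < t" "x \<in> A q"
          by auto
        then show "x \<in> {x \<in> space M. T x < t}"
          using T_le[of x q] A(1)[of q] sets.sets_into_space by fastforce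
      qed
      moreover have "(\<Union>q\<in>\<rat> \<inter> {a..<t}. A q) \<in> sets M"
        by (rule sets.countable_UN'') (auto intro: A countable_rat countable_subset)
      ultimately show ?thesis
        by simp
    next
      case False
      then have "T x < t" for x
        using T_le_b[of x] by linarith
      then have "{x \<in> space M. T x < t} = space M"
        by simp
      then show ?thesis by simp
    qed
  qed
  note [measurable] = T_meas
  have T_sets: "{x \<in> J. T x < q} \<in> sets M" "{x \<in> J. T x \<le> q} \<in> sets M" for q
    by (intro sets_Collect_subset[OF J]; measurable)+
  show ?thesis
  proof (intro bexI[OF _ T_meas] ballI conjI impI)
    fix q :: real assume q: "q \<in> \<rat>"
    show "G q \<le> measure M {x \<in> J. T x \<le> q}"
    proof (cases "q < a")
      case False
      then have "A q \<subseteq> {x \<in> J. T x \<le> q}"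
        using T_le[of _ q] AJ[OF q] q by auto
      then have "measure M (A q) \<le> measure M {x \<in> J. T x \<le> q}"
        using T_sets by (intro finite_measure_mono)
      then show ?thesis
        using A(3)[OF q] by simp
    qed (use G_low[OF q] in simp)
    show "measure M {x \<in> J. T x < q} \<le> G q"
    proof (cases "q \<le> b")
      case True
      then have "{x \<in> J. T x < q} \<subseteq> A q"
        using T_less_A q by auto
      then have "measure M {x \<in> J. T x < q} \<le> measure M (A q)"
        using A(1)[OF q] by (intro finite_measure_mono)
      then show ?thesis
        using A(3)[OF q] by simp
    next
      case False
      then show ?thesis
        using G_high[OF q] J T_sets by (auto intro!: finite_measure_mono)
    qed
  next
    fix q :: real and E assume q: "q \<in> \<rat>" and E: "E \<in> sets M" "lex_initial r J E"
      and le: "G q \<le> measure M E"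
    show "AE x in M. x \<in> J \<longrightarrow> T x < q \<longrightarrow> x \<in> E"
    proof (cases "q \<le> b")
      case True
      have "AE x in M. x \<in> A q \<longrightarrow> x \<in> E"
        using AE_subset_lex_initial[OF A(1)[OF q] E(1) A(2)[OF q] E(2)] le A(3)[OF q] by simp
      then show ?thesis
        by eventually_elim (use T_less_A True q in auto)
    next
      case False
      have "AE x in M. x \<in> J \<longrightarrow> x \<in> E"
        using AE_subset_lex_initial[OF J E(1) _ E(2)] le G_high[OF q] False
        by (auto simp: lex_initial_def)
      then show ?thesis
        by eventually_elim auto
    qed
  next
    fix q :: real and E assume q: "q \<in> \<rat>" and E: "E \<in> sets M" "lex_initial r J E"
      and le: "measure M E \<le> G q"
    show "AE x in M. x \<in> E \<longrightarrow> T x \<le> q"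
    proof (cases "q < a")
      case True
      then have "E \<in> null_sets M"
        using E le G_low[OF q] by (auto simp: null_sets_def emeasure_eq_measure measure_le_0_iff)
      then show ?thesis
        by (rule AE_I') auto
    next
      case False
      have "AE x in M. x \<in> E \<longrightarrow> x \<in> A q"
        using AE_subset_lex_initial[OF E(1) A(1)[OF q] E(2) A(2)[OF q]] le A(3)[OF q] by simp
      then show ?thesis
        by eventually_elim (use T_le False q in auto)
    qed
  qed
qed

section \<open>Replacing envelopes by a map on one cluster\<close>

text \<open>Any map between \<open>P\<close> and \<open>Q\<close> on the cluster keeps the
  oscillation bound \<open>L\<close>, both inside the cluster and against the envelopes outside. The
  common rank \<open>r\<close> lets a rearrangement along \<open>r\<close> respect both bounds at
  once.\<close>

lemma comonotone_bounds:
  fixes l h :: "real \<Rightarrow> real" and p \<delta> L a b :: real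
  defines "J \<equiv> {x \<in> \<Omega>. p \<le> x \<and> x < p + \<delta>}"
  assumes ne: "J \<noteq> {}"
    and range: "\<And>x. x \<in> \<Omega> \<Longrightarrow> a \<le> l x \<and> l x \<le> h x \<and> h x \<le> b"
    and osc: "\<And>x x'. x \<in> \<Omega> \<Longrightarrow> x' \<in> \<Omega> \<Longrightarrow> \<bar>x - x'\<bar> < \<delta> \<Longrightarrow> h x - l x' \<le> L"
  obtains P Q r :: "real \<Rightarrow> real" and C :: real where
    "P \<in> borel_measurable M" "Q \<in> borel_measurable M" "r \<in> borel_measurable M"
    "\<And>x. x \<in> J \<Longrightarrow> \<bar>r x\<bar> \<le> C"
    "\<And>x y. x \<in> J \<Longrightarrow> y \<in> J \<Longrightarrow> r x \<le> r y \<Longrightarrow> P x \<le> P y \<and> Q x \<le> Q y"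
    "\<And>x. x \<in> J \<Longrightarrow> P x \<le> l x \<and> h x \<le> Q x"
    "\<And>x y. x \<in> J \<Longrightarrow> y \<in> J \<Longrightarrow> Q x - P y \<le> L"
    "\<And>x z. x \<in> J \<Longrightarrow> z \<in> \<Omega> - J \<Longrightarrow> \<bar>x - z\<bar> < \<delta> \<Longrightarrow> Q x - l z \<le> L \<and> h z - P x \<le> L"
proof -
  define hJ where "hJ = Sup (h ` J)"
  define lJ where "lJ = Inf (l ` J)"
  have J\<Omega>: "J \<subseteq> \<Omega>"
    by (auto simp: J_def)
  have near: "\<bar>x - y\<bar> < \<delta>" if "x \<in> J" "y \<in> J" for x y
    using that by (auto simp: J_def)
  have bdd_h: "bdd_above (h ` J)" and bdd_l: "bdd_below (l ` J)"
    using range J\<Omega> by (auto intro!: bdd_aboveI[of _ b] bdd_belowI[of _ a] simp: subset_iff)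
  have hJ: "h x \<le> hJ" and lJ: "lJ \<le> l x" if "x \<in> J" for x
    using that bdd_h bdd_l by (auto simp: hJ_def lJ_def intro: cSUP_upper cINF_lower)
  have lh: "l x \<le> h x" "a \<le> l x" "h x \<le> b" if "x \<in> \<Omega>" for x
    using range[OF that] by auto
  have osc_J: "hJ - lJ \<le> L"
  proof -
    have "hJ \<le> L + l y" if "y \<in> J" for y
      unfolding hJ_def using ne osc[OF _ _ near[OF _ that]] that J\<Omega>
      by (intro cSUP_least) (auto simp: algebra_simps subset_iff)
    then have "hJ - L \<le> lJ"
      unfolding lJ_def using ne by (intro cINF_greatest) (auto simp: algebra_simps)
    then show ?thesis
      by simp
  qed
  \<comment> \<open>For \<open>x\<close> in the cluster, its \<delta>-neighbours outside are
    \<open>R x\<close> on the right and \<open>F x\<close> on the left. Moving \<open>x\<close> to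
    the right enlarges \<open>R x\<close> and shrinks \<open>F x\<close>.\<close>
  define R where "R x = {z \<in> \<Omega>. p + \<delta> \<le> z \<and> z < x + \<delta>}" for x
  define F where "F x = {z \<in> \<Omega>. x - \<delta> < z \<and> z < p}" for x
  have R_mono: "R x \<subseteq> R y" and F_mono: "F y \<subseteq> F x" if "x \<le> y" for x y
    using that by (auto simp: R_def F_def)
  have R\<Omega>: "R x \<subseteq> \<Omega>" and F\<Omega>: "F x \<subseteq> \<Omega>" for x
    by (auto simp: R_def F_def)
  \<comment> \<open>The tightest bounds that the envelopes on \<open>Z\<close> force on values in
    the cluster, clamped at \<open>lJ\<close> and \<open>hJ\<close>. The clamping covers empty
    \<open>Z\<close> and yields \<open>Q x - P y \<le> hJ - lJ \<le> L\<close>.\<close>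
  define lower where "lower Z = Sup (insert lJ ((\<lambda>z. h z - L) ` Z))" for Z
  define upper where "upper Z = Inf (insert hJ ((\<lambda>z. L + l z) ` Z))" for Z
  have bdd_lower: "bdd_above (insert lJ ((\<lambda>z. h z - L) ` Z))"
    and bdd_upper: "bdd_below (insert hJ ((\<lambda>z. L + l z) ` Z))" if "Z \<subseteq> \<Omega>" for Z
    using lh that
    by (auto intro!: bdd_aboveI[of _ "b - L"] bdd_belowI[of _ "L + a"] simp: subset_iff)
  have lower_mono: "lower Z \<le> lower Z'" and upper_mono: "upper Z' \<le> upper Z"
    if "Z \<subseteq> Z'" "Z' \<subseteq> \<Omega>" for Z Z'
    unfolding lower_def upper_def using that bdd_lower[OF that(2)] bdd_upper[OF that(2)]
    by (auto intro!: cSup_subset_mono cInf_superset_mono)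
  have lower_ge: "lJ \<le> lower Z" and upper_le: "upper Z \<le> hJ"
    and lower_ge': "z \<in> Z \<Longrightarrow> h z - L \<le> lower Z" and upper_le': "z \<in> Z \<Longrightarrow> upper Z \<le> L + l z"
    if "Z \<subseteq> \<Omega>" for Z z
    unfolding lower_def upper_def using bdd_lower[OF that] bdd_upper[OF that]
    by (auto intro: cSup_upper cInf_lower)
  have lower_le: "lower Z \<le> l x" and upper_ge: "h x \<le> upper Z"
    if "x \<in> J" "Z \<subseteq> \<Omega>" "\<And>z. z \<in> Z \<Longrightarrow> \<bar>x - z\<bar> < \<delta>" for x Z
  proof -
    have "h z - L \<le> l x" "h x \<le> L + l z" if "z \<in> Z" for z
      using osc[of x z] osc[of z x] that \<open>x \<in> J\<close> J\<Omega> \<open>Z \<subseteq> \<Omega>\<close> \<open>\<And>z. z \<in> Z \<Longrightarrow> \<bar>x - z\<bar> < \<delta>\<close>[OF that]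
      by (auto simp: abs_minus_commute subset_iff algebra_simps)
    then show "lower Z \<le> l x" "h x \<le> upper Z"
      unfolding lower_def upper_def using hJ[OF \<open>x \<in> J\<close>] lJ[OF \<open>x \<in> J\<close>]
      by (auto intro!: cSup_least cInf_greatest)
  qed
  have R_near: "\<bar>x - z\<bar> < \<delta>" if "x \<in> J" "z \<in> R x" for x z
    using that by (auto simp: R_def J_def)
  have F_near: "\<bar>x - z\<bar> < \<delta>" if "x \<in> J" "z \<in> F x" for x z
    using that by (auto simp: F_def J_def)
  \<comment> \<open>If both bounds were active, the oscillation over \<open>\<Union>\<Z>\<close> plus that over \<open>J\<close> would exceed \<open>2L\<close>.\<close>
  have one_sided: "(\<forall>Z\<in>\<Z>. upper Z = hJ) \<or> (\<forall>Z\<in>\<Z>. lower Z = lJ)"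
    if sub: "\<And>Z. Z \<in> \<Z> \<Longrightarrow> Z \<subseteq> \<Omega>" and close: "\<And>z z'. z \<in> \<Union>\<Z> \<Longrightarrow> z' \<in> \<Union>\<Z> \<Longrightarrow> \<bar>z - z'\<bar> < \<delta>" for \<Z>
  proof (rule ccontr)
    assume "\<not> ?thesis"
    then obtain Z Z' where Z: "Z \<in> \<Z>" "upper Z < hJ" "Z' \<in> \<Z>" "lJ < lower Z'"
      using upper_le lower_ge sub by (metis order.not_eq_order_implies_strict)
    obtain z where z: "z \<in> Z" "L + l z < hJ"
      using cInf_lessD[OF _ Z(2)[unfolded upper_def]] by auto
    obtain z' where z': "z' \<in> Z'" "lJ < h z' - L"
      using less_cSupD[OF _ Z(4)[unfolded lower_def]] by auto
    have "h z' - l z \<le> L"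
      using z(1) z'(1) Z sub close by (intro osc) blast+
    then show False
      using z(2) z'(2) osc_J by linarith
  qed
  have right: "(\<forall>x\<in>J. upper (R x) = hJ) \<or> (\<forall>x\<in>J. lower (R x) = lJ)"
  proof -
    \<comment> \<open>All right neighbours lie in the half-open interval from
      \<open>p + \<delta>\<close> to \<open>p + 2 * \<delta>\<close>, of length \<delta>.\<close>
    have "\<bar>z - z'\<bar> < \<delta>" if "z \<in> \<Union>(R ` J)" "z' \<in> \<Union>(R ` J)" for z z'
      using that by (auto simp: R_def J_def)
    moreover have "Z \<subseteq> \<Omega>" if "Z \<in> R ` J" for Z
      using that R\<Omega> by blast
    ultimately show ?thesis
      using one_sided[of "R ` J"] by blast
  qed
  have left: "(\<forall>x\<in>J. upper (F x) = hJ) \<or> (\<forall>x\<in>J. lower (F x) = lJ)"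
  proof -
    have "\<bar>z - z'\<bar> < \<delta>" if "z \<in> \<Union>(F ` J)" "z' \<in> \<Union>(F ` J)" for z z'
      using that by (auto simp: F_def J_def)
    moreover have "Z \<subseteq> \<Omega>" if "Z \<in> F ` J" for Z
      using that F\<Omega> by blast
    ultimately show ?thesis
      using one_sided[of "F ` J"] by blast
  qed
  define P where "P x = max (lower (R x)) (lower (F x))" for x
  define Q where "Q x = min (upper (R x)) (upper (F x))" for x
  have meas_mono: "f \<in> borel_measurable M" if "\<And>x y. x \<le> y \<Longrightarrow> f x \<le> f y" for f :: "real \<Rightarrow> real"
    using that by (intro borel_measurableI borel_measurable_mono_on_fnc) (simp add: mono_onI)
  have meas_antimono: "f \<in> borel_measurable M" if "\<And>x y. x \<le> y \<Longrightarrow> f y \<le> f x" for f :: "real \<Rightarrow> real"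
    using borel_measurable_uminus[OF meas_mono[of "\<lambda>x. - f x"]] that by simp
  have [measurable]: "(\<lambda>x. lower (R x)) \<in> borel_measurable M" "(\<lambda>x. lower (F x)) \<in> borel_measurable M"
    "(\<lambda>x. upper (R x)) \<in> borel_measurable M" "(\<lambda>x. upper (F x)) \<in> borel_measurable M"
    using lower_mono upper_mono R_mono F_mono R\<Omega> F\<Omega>
    by (auto intro: meas_mono meas_antimono)
  have P_meas[measurable]: "P \<in> borel_measurable M" and Q_meas[measurable]: "Q \<in> borel_measurable M"
    unfolding P_def Q_def by measurable
  have between: "P x \<le> l x" "h x \<le> Q x" if "x \<in> J" for x
    using lower_le[OF that R\<Omega> R_near[OF that]] lower_le[OF that F\<Omega> F_near[OF that]]
      upper_ge[OF that R\<Omega> R_near[OF that]] upper_ge[OF that F\<Omega> F_near[OF that]]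
    by (auto simp: P_def Q_def)
  have P_lJ: "lJ \<le> P x" and Q_hJ: "Q x \<le> hJ" for x
    using lower_ge[OF R\<Omega>] upper_le[OF R\<Omega>] by (auto simp: P_def Q_def le_max_iff_disj min_le_iff_disj)
  have outside: "Q x - l z \<le> L" "h z - P x \<le> L" if "x \<in> J" "z \<in> \<Omega> - J" "\<bar>x - z\<bar> < \<delta>" for x z
  proof -
    have "z \<in> R x \<or> z \<in> F x"
      using that by (auto simp: R_def F_def J_def)
    then have "upper (R x) \<le> L + l z \<and> h z - L \<le> lower (R x) \<or>
        upper (F x) \<le> L + l z \<and> h z - L \<le> lower (F x)"
      using upper_le'[OF R\<Omega>] upper_le'[OF F\<Omega>] lower_ge'[OF R\<Omega>] lower_ge'[OF F\<Omega>] by blast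
    then show "Q x - l z \<le> L" "h z - P x \<le> L"
      by (auto simp: P_def Q_def)
  qed
  obtain r :: "real \<Rightarrow> real" and C :: real where r: "r \<in> borel_measurable M" "\<And>x. x \<in> J \<Longrightarrow> \<bar>r x\<bar> \<le> C"
    "\<And>x y. x \<in> J \<Longrightarrow> y \<in> J \<Longrightarrow> r x \<le> r y \<Longrightarrow> P x \<le> P y \<and> Q x \<le> Q y"
  proof -
    obtain D where D: "\<And>x. x \<in> \<Omega> \<Longrightarrow> \<bar>x\<bar> \<le> D"
      using bounded_\<Omega> by (auto simp: bounded_iff)
    have PQ_bounds: "\<bar>P x\<bar> \<le> \<bar>lJ\<bar> + \<bar>b\<bar>" "\<bar>Q x\<bar> \<le> \<bar>hJ\<bar> + \<bar>a\<bar>" if "x \<in> J" for x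
      using P_lJ[of x] Q_hJ[of x] between[OF that] lh[of x] that J\<Omega> by auto
    \<comment> \<open>An inactive bound drops out. In case \<open>P\<close> the function
      \<open>Q\<close> is constant on \<open>J\<close>, and in case \<open>Q\<close> the function
      \<open>P\<close> is. In \<open>inc\<close>, \<open>P x = lower (R x)\<close> and
      \<open>Q x = upper (F x)\<close> both grow as \<open>x\<close> moves right; \<open>dec\<close>
      is the mirror image, with rank \<open>- x\<close>.\<close>
    consider (P) "\<forall>x\<in>J. upper (R x) = hJ" "\<forall>x\<in>J. upper (F x) = hJ"
      | (inc) "\<forall>x\<in>J. upper (R x) = hJ" "\<forall>x\<in>J. lower (F x) = lJ"
      | (dec) "\<forall>x\<in>J. lower (R x) = lJ" "\<forall>x\<in>J. upper (F x) = hJ"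
      | (Q) "\<forall>x\<in>J. lower (R x) = lJ" "\<forall>x\<in>J. lower (F x) = lJ"
      using right left by blast
    then show ?thesis
    proof cases
      case P
      then show ?thesis
        by (intro that[of P "\<bar>lJ\<bar> + \<bar>b\<bar>"] P_meas PQ_bounds) (auto simp: Q_def)
    next
      case Q
      then show ?thesis
        by (intro that[of Q "\<bar>hJ\<bar> + \<bar>a\<bar>"] Q_meas PQ_bounds) (auto simp: P_def)
    next
      case inc
      then have "P x = lower (R x)" "Q x = upper (F x)" if "x \<in> J" for x
        using that lower_ge[OF R\<Omega>] upper_le[OF F\<Omega>] by (simp_all add: P_def Q_def max_absorb1 min_absorb2)
      then show ?thesis
        using D J\<Omega> lower_mono[OF R_mono R\<Omega>] upper_mono[OF F_mono F\<Omega>]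
        by (intro that[of "\<lambda>x. x" D]) auto
    next
      case dec
      then have "P x = lower (F x)" "Q x = upper (R x)" if "x \<in> J" for x
        using that lower_ge[OF F\<Omega>] upper_le[OF R\<Omega>] by (simp_all add: P_def Q_def max_absorb2 min_absorb1)
      then show ?thesis
        using D J\<Omega> lower_mono[OF F_mono F\<Omega>] upper_mono[OF R_mono R\<Omega>]
        by (intro that[of "\<lambda>x. - x" D]) auto
    qed
  qed
  show ?thesis
  proof (rule that[OF P_meas Q_meas r(1)])
    show "Q x - P y \<le> L" for x y
      using Q_hJ[of x] P_lJ[of y] osc_J by linarith
  qed (use r(2,3) between outside in blast)+
qed

text \<open>Rearrange along the rank from \<open>comonotone_bounds\<close>. Sublevel sets of
  \<open>P\<close> and \<open>Q\<close> are initial segments whose masses \<open>G_l\<close> and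
  \<open>G_h\<close> compare with \<open>G\<close>, so the result lies between \<open>P\<close> and
  \<open>Q\<close> almost everywhere; \<open>G_gap\<close> puts its values into
  \<open>\<Omega>'\<close>.\<close>

lemma cluster_step:
  fixes l h G :: "real \<Rightarrow> real" and p \<delta> L a b :: real
  defines "J \<equiv> {x \<in> \<Omega>. p \<le> x \<and> x < p + \<delta>}"
  assumes "closed \<Omega>'" "\<Omega>' \<subseteq> {a..b}" "a \<le> b"
    and l_meas[measurable]: "l \<in> borel_measurable M" and h_meas[measurable]: "h \<in> borel_measurable M"
    and range: "\<And>x. x \<in> \<Omega> \<Longrightarrow> l x \<in> \<Omega>' \<and> h x \<in> \<Omega>' \<and> l x \<le> h x"
    and osc: "\<And>x x'. x \<in> \<Omega> \<Longrightarrow> x' \<in> \<Omega> \<Longrightarrow> \<bar>x - x'\<bar> < \<delta> \<Longrightarrow> h x - l x' \<le> L"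
    and G_mono: "\<And>q q'. q \<in> \<rat> \<Longrightarrow> q' \<in> \<rat> \<Longrightarrow> q \<le> q' \<Longrightarrow> G q \<le> G q'"
    and G_range: "\<And>q. q \<in> \<rat> \<Longrightarrow> 0 \<le> G q \<and> G q \<le> measure M J"
    and G_low: "\<And>q. q \<in> \<rat> \<Longrightarrow> q < a \<Longrightarrow> G q = 0"
    and G_high: "\<And>q. q \<in> \<rat> \<Longrightarrow> q \<ge> b \<Longrightarrow> G q = measure M J"
    and G_gap: "\<And>s t. s \<in> \<rat> \<Longrightarrow> t \<in> \<rat> \<Longrightarrow> s < t \<Longrightarrow> {s<..t} \<inter> \<Omega>' = {} \<Longrightarrow> G t \<le> G s"
    and G_h: "\<And>q. q \<in> \<rat> \<Longrightarrow> measure M J - G q \<le> measure M {x \<in> J. q \<le> h x}"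
    and G_l: "\<And>q. q \<in> \<rat> \<Longrightarrow> G q \<le> measure M {x \<in> J. l x \<le> q}"
  obtains T where "T \<in> borel_measurable M" "\<And>x. x \<in> J \<Longrightarrow> T x \<in> \<Omega>'"
    "\<And>x y. x \<in> J \<Longrightarrow> y \<in> J \<Longrightarrow> T x - T y \<le> L"
    "\<And>x z. x \<in> J \<Longrightarrow> z \<in> \<Omega> - J \<Longrightarrow> \<bar>x - z\<bar> < \<delta> \<Longrightarrow> T x - l z \<le> L \<and> h z - T x \<le> L"
    "\<And>q. q \<in> \<rat> \<Longrightarrow> G q \<le> measure M {x \<in> J. T x \<le> q}"
    "\<And>q. q \<in> \<rat> \<Longrightarrow> measure M {x \<in> J. T x < q} \<le> G q"
proof (cases "J = {}")
  case True
  show ?thesis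
    by (rule that[of h]) (use True G_range in auto)
next
  case False
  have J: "J \<in> sets M"
    unfolding J_def space_eq[symmetric] by measurable
  have J\<Omega>: "J \<subseteq> \<Omega>"
    by (auto simp: J_def)
  have range': "a \<le> l x \<and> l x \<le> h x \<and> h x \<le> b" if "x \<in> \<Omega>" for x
    using range[OF that] \<open>\<Omega>' \<subseteq> {a..b}\<close> by auto
  obtain P Q r :: "real \<Rightarrow> real" and C :: real where PQ[measurable]: "P \<in> borel_measurable M" "Q \<in> borel_measurable M"
    and r: "r \<in> borel_measurable M" "\<And>x. x \<in> J \<Longrightarrow> \<bar>r x\<bar> \<le> C"
      "\<And>x y. x \<in> J \<Longrightarrow> y \<in> J \<Longrightarrow> r x \<le> r y \<Longrightarrow> P x \<le> P y \<and> Q x \<le> Q y"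
    and between: "\<And>x. x \<in> J \<Longrightarrow> P x \<le> l x \<and> h x \<le> Q x"
    and inside: "\<And>x y. x \<in> J \<Longrightarrow> y \<in> J \<Longrightarrow> Q x - P y \<le> L"
    and outside: "\<And>x z. x \<in> J \<Longrightarrow> z \<in> \<Omega> - J \<Longrightarrow> \<bar>x - z\<bar> < \<delta> \<Longrightarrow> Q x - l z \<le> L \<and> h z - P x \<le> L"
    using comonotone_bounds[of p \<delta> a l h b L, folded J_def, OF False range' osc] by blast
  have "\<exists>T \<in> borel_measurable M. \<forall>q\<in>\<rat>.
    G q \<le> measure M {x \<in> J. T x \<le> q} \<and> measure M {x \<in> J. T x < q} \<le> G q \<and>
    (\<forall>E\<in>sets M. lex_initial r J E \<longrightarrow>
      (G q \<le> measure M E \<longrightarrow> (AE x in M. x \<in> J \<longrightarrow> T x < q \<longrightarrow> x \<in> E)) \<and>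
      (measure M E \<le> G q \<longrightarrow> (AE x in M. x \<in> E \<longrightarrow> T x \<le> q)))"
    by (rule rearrangement[where G = G, OF J r(1,2) G_mono G_range G_low G_high \<open>a \<le> b\<close>])
  then obtain T where T[measurable]: "T \<in> borel_measurable M"
    and T_cdf: "\<forall>q\<in>\<rat>.
      G q \<le> measure M {x \<in> J. T x \<le> q} \<and> measure M {x \<in> J. T x < q} \<le> G q \<and>
      (\<forall>E\<in>sets M. lex_initial r J E \<longrightarrow>
        (G q \<le> measure M E \<longrightarrow> (AE x in M. x \<in> J \<longrightarrow> T x < q \<longrightarrow> x \<in> E)) \<and>
        (measure M E \<le> G q \<longrightarrow> (AE x in M. x \<in> E \<longrightarrow> T x \<le> q)))"
    by (rule bexE)
  have cdf_le: "G q \<le> measure M {x \<in> J. T x \<le> q}"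
    and cdf_less: "measure M {x \<in> J. T x < q} \<le> G q" if "q \<in> \<rat>" for q
    using bspec[OF T_cdf that] by blast+
  have T_less: "AE x in M. x \<in> J \<longrightarrow> T x < q \<longrightarrow> x \<in> E"
    if "q \<in> \<rat>" "E \<in> sets M" "lex_initial r J E" "G q \<le> measure M E" for q E
    using bspec[OF T_cdf that(1)] that by blast
  have T_le: "AE x in M. x \<in> E \<longrightarrow> T x \<le> q"
    if "q \<in> \<rat>" "E \<in> sets M" "lex_initial r J E" "measure M E \<le> G q" for q E
    using bspec[OF T_cdf that(1)] that by blast
  have sets_P: "{x \<in> J. P x \<le> q} \<in> sets M" "{x \<in> J. Q x < q} \<in> sets M" "{x \<in> J. q \<le> Q x} \<in> sets M"
    "{x \<in> J. T x \<le> q} \<in> sets M" "{x \<in> J. T x < q} \<in> sets M" for q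
    by (intro sets_Collect_subset[OF J]; measurable)+
  \<comment> \<open>The initial segment \<open>{x \<in> J. P x \<le> q}\<close> contains
    \<open>{x \<in> J. l x \<le> q}\<close>, so its mass is at least \<open>G q\<close> and it
    absorbs almost all of \<open>{x \<in> J. T x < q}\<close>.\<close>
  have "AE x in M. x \<in> J \<longrightarrow> T x < q \<longrightarrow> P x \<le> q" if q: "q \<in> \<rat>" for q
  proof -
    have "lex_initial r J {x \<in> J. P x \<le> q}"
    proof (rule lex_initial_lower)
      show "y \<in> {x \<in> J. P x \<le> q}" if "x \<in> {x \<in> J. P x \<le> q}" "y \<in> J" "r y \<le> r x" for x y
        using r(3)[of y x] that by simp
    qed auto
    moreover have "{x \<in> J. l x \<le> q} \<subseteq> {x \<in> J. P x \<le> q}"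
      using between order_trans by blast
    then have "G q \<le> measure M {x \<in> J. P x \<le> q}"
      using order_trans[OF G_l[OF q] finite_measure_mono] sets_P by blast
    ultimately show ?thesis
      using T_less[OF q sets_P(1), of q] by auto
  qed
  then have "AE x in M. \<forall>q\<in>\<rat>. x \<in> J \<longrightarrow> T x < q \<longrightarrow> P x \<le> q"
    by (simp only: AE_ball_countable[OF countable_rat]) blast
  then have T_ge_P: "AE x in M. x \<in> J \<longrightarrow> P x \<le> T x"
    by eventually_elim (meson Rats_dense_in_real not_le)
  \<comment> \<open>Dually, \<open>{x \<in> J. Q x < q}\<close> is disjoint from
    \<open>{x \<in> J. q \<le> h x}\<close>, so its mass is at most \<open>G q\<close>.\<close>
  have "AE x in M. x \<in> J \<longrightarrow> Q x < q \<longrightarrow> T x \<le> q" if q: "q \<in> \<rat>" for q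
  proof -
    have "lex_initial r J {x \<in> J. Q x < q}"
    proof (rule lex_initial_lower)
      show "y \<in> {x \<in> J. Q x < q}" if "x \<in> {x \<in> J. Q x < q}" "y \<in> J" "r y \<le> r x" for x y
        using r(3)[of y x] that by simp
    qed auto
    moreover have "measure M {x \<in> J. Q x < q} \<le> G q"
    proof -
      have "{x \<in> J. q \<le> h x} \<subseteq> {x \<in> J. q \<le> Q x}"
        using between order_trans by blast
      then have "measure M {x \<in> J. q \<le> h x} \<le> measure M {x \<in> J. q \<le> Q x}"
        using sets_P finite_measure_mono by blast
      moreover have "measure M J = measure M {x \<in> J. Q x < q} + measure M {x \<in> J. q \<le> Q x}"
        using sets_P by (subst finite_measure_Union[symmetric]) (auto intro!: arg_cong[of _ _ "measure M"])
      ultimately show ?thesis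
        using G_h[OF q] by linarith
    qed
    ultimately show ?thesis
      using T_le[OF q sets_P(2), of q] by auto
  qed
  then have "AE x in M. \<forall>q\<in>\<rat>. x \<in> J \<longrightarrow> Q x < q \<longrightarrow> T x \<le> q"
    by (simp only: AE_ball_countable[OF countable_rat]) blast
  then have T_le_Q: "AE x in M. x \<in> J \<longrightarrow> T x \<le> Q x"
    by eventually_elim (meson Rats_dense_in_real not_le)
  \<comment> \<open>Across a gap, the mass of \<open>T x < t\<close> is at most
    \<open>G t \<le> G s\<close>, hence at most that of \<open>T x \<le> s\<close>; nothing is left
    strictly between. Countably many rational gaps cover the complement of the closed set
    \<open>\<Omega>'\<close>.\<close>
  have "AE x in M. {s<..t} \<inter> \<Omega>' = {} \<longrightarrow> x \<in> J \<longrightarrow> \<not> (s < T x \<and> T x < t)"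
    if st: "s \<in> \<rat>" "t \<in> \<rat>" for s t
  proof (cases "s < t \<and> {s<..t} \<inter> \<Omega>' = {}")
    case True
    have "measure M ({x \<in> J. T x < t} - {x \<in> J. T x \<le> s}) =
        measure M {x \<in> J. T x < t} - measure M {x \<in> J. T x \<le> s}"
      using True sets_P by (intro finite_measure_Diff) auto
    also have "\<dots> \<le> 0"
      using cdf_le[OF st(1)] cdf_less[OF st(2)] G_gap[OF st] True by fastforce
    finally have "{x \<in> J. T x < t} - {x \<in> J. T x \<le> s} \<in> null_sets M"
      using sets_P by (auto simp: null_sets_def emeasure_eq_measure measure_le_0_iff)
    then show ?thesis
      by (rule AE_I') auto
  qed (auto intro!: AE_I2)
  then have "AE x in M. \<forall>s\<in>\<rat>. \<forall>t\<in>\<rat>. {s<..t} \<inter> \<Omega>' = {} \<longrightarrow> x \<in> J \<longrightarrow> \<not> (s < T x \<and> T x < t)"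
    by (simp only: AE_ball_countable[OF countable_rat]) blast
  then have T_\<Omega>': "AE x in M. x \<in> J \<longrightarrow> T x \<in> \<Omega>'"
  proof eventually_elim
    case (elim x)
    show ?case
    proof (rule impI, rule ccontr)
      assume "x \<in> J" "T x \<notin> \<Omega>'"
      then obtain e where e: "e > 0" "\<And>y. \<bar>y - T x\<bar> < e \<Longrightarrow> y \<notin> \<Omega>'"
        using \<open>closed \<Omega>'\<close> unfolding closed_def open_dist by (force simp: dist_real_def)
      obtain s where s: "s \<in> \<rat>" "T x - e < s" "s < T x"
        using Rats_dense_in_real[of "T x - e" "T x"] e(1) by auto
      obtain t where t: "t \<in> \<rat>" "T x < t" "t < T x + e"
        using Rats_dense_in_real[of "T x" "T x + e"] e(1) by auto
      have "{s<..t} \<inter> \<Omega>' = {}"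
        using e(2) s t by (force simp: abs_less_iff)
      then show False
        using elim s t \<open>x \<in> J\<close> by blast
    qed
  qed
  \<comment> \<open>On the cluster, \<open>h\<close> lies between \<open>P\<close> and
    \<open>Q\<close> with values in \<open>\<Omega>'\<close>, so it repairs the exceptional null set
    pointwise without affecting the distribution.\<close>
  define T' where "T' x = (if P x \<le> T x \<and> T x \<le> Q x \<and> T x \<in> \<Omega>' then T x else h x)" for x
  have [measurable]: "\<Omega>' \<in> sets borel"
    using \<open>closed \<Omega>'\<close> by simp
  have T'_meas[measurable]: "T' \<in> borel_measurable M"
    unfolding T'_def by measurable
  have T'_eq: "AE x in M. x \<in> J \<longrightarrow> T' x = T x"
    using T_ge_P T_le_Q T_\<Omega>' by eventually_elim (auto simp: T'_def)
  have T'_PQ: "P x \<le> T' x" "T' x \<le> Q x" if "x \<in> J" for x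
    using between[OF that] range'[of x] that J\<Omega> by (auto simp: T'_def)
  have sets_T': "{x \<in> J. T' x \<le> q} \<in> sets M" "{x \<in> J. T' x < q} \<in> sets M" for q
    by (intro sets_Collect_subset[OF J]; measurable)+
  have cdf_eq: "measure M {x \<in> J. T' x \<le> q} = measure M {x \<in> J. T x \<le> q}"
    "measure M {x \<in> J. T' x < q} = measure M {x \<in> J. T x < q}" for q
    by (rule finite_measure_eq_AE[OF _ sets_T'(1) sets_P(4)], use T'_eq in eventually_elim, force)
      (rule finite_measure_eq_AE[OF _ sets_T'(2) sets_P(5)], use T'_eq in eventually_elim, force)
  show ?thesis
  proof (rule that[OF T'_meas])
    show "T' x \<in> \<Omega>'" if "x \<in> J" for x
      using range[of x] that J\<Omega> by (auto simp: T'_def)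
    show "T' x - T' y \<le> L" if "x \<in> J" "y \<in> J" for x y
      using inside[OF that] T'_PQ[OF that(1)] T'_PQ[OF that(2)] by linarith
    show "T' x - l z \<le> L \<and> h z - T' x \<le> L" if "x \<in> J" "z \<in> \<Omega> - J" "\<bar>x - z\<bar> < \<delta>" for x z
      using outside[OF that] T'_PQ[OF that(1)] by linarith
  qed (use cdf_eq cdf_le cdf_less in auto)
qed

section \<open>Assembling the clusters\<close>

definition cluster :: "real \<Rightarrow> int \<Rightarrow> real set" where
  "cluster \<delta> k = {x \<in> \<Omega>. of_int k * \<delta> \<le> x \<and> x < of_int k * \<delta> + \<delta>}"

text \<open>An interval-valued competitor: for \<open>l = h\<close> on \<open>\<Omega>\<close> it is
  a measurable map into \<open>\<Omega>'\<close> whose values at points closer than \<delta> differ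
  by at most \<open>L\<close>.\<close>

definition relaxed_map :: "real set \<Rightarrow> real \<Rightarrow> real \<Rightarrow> (real \<Rightarrow> real) \<Rightarrow> (real \<Rightarrow> real) \<Rightarrow> bool" where
  "relaxed_map \<Omega>' \<delta> L l h \<longleftrightarrow> l \<in> borel_measurable M \<and> h \<in> borel_measurable M \<and>
     (\<forall>x\<in>\<Omega>. l x \<in> \<Omega>' \<and> h x \<in> \<Omega>' \<and> l x \<le> h x) \<and>
     (\<forall>x\<in>\<Omega>. \<forall>x'\<in>\<Omega>. \<bar>x - x'\<bar> < \<delta> \<longrightarrow> h x - l x' \<le> L)"

text \<open>\<open>G\<close> is used at rational arguments only. The last two conditions say that the prescribed mass
  above \<open>q\<close> fits under \<open>h\<close> and the prescribed mass below \<open>q\<close> fits above \<open>l\<close>.\<close>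

definition relaxed_cdf ::
  "real set \<Rightarrow> real \<Rightarrow> real \<Rightarrow> real set \<Rightarrow> (real \<Rightarrow> real) \<Rightarrow> (real \<Rightarrow> real) \<Rightarrow> (real \<Rightarrow> real) \<Rightarrow> bool" where
  "relaxed_cdf \<Omega>' a b J l h G \<longleftrightarrow>
     (\<forall>q\<in>\<rat>. \<forall>q'\<in>\<rat>. q \<le> q' \<longrightarrow> G q \<le> G q') \<and>
     (\<forall>q\<in>\<rat>. 0 \<le> G q \<and> G q \<le> measure M J) \<and>
     (\<forall>q\<in>\<rat>. q < a \<longrightarrow> G q = 0) \<and>
     (\<forall>q\<in>\<rat>. b \<le> q \<longrightarrow> G q = measure M J) \<and>
     (\<forall>s\<in>\<rat>. \<forall>t\<in>\<rat>. s < t \<longrightarrow> {s<..t} \<inter> \<Omega>' = {} \<longrightarrow> G t \<le> G s) \<and>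
     (\<forall>q\<in>\<rat>. measure M J - G q \<le> measure M {x \<in> J. q \<le> h x}) \<and>
     (\<forall>q\<in>\<rat>. G q \<le> measure M {x \<in> J. l x \<le> q})"

text \<open>The strict and non-strict inequalities leave room for \<open>G\<close> failing to be right-continuous; summed
  over the clusters they still determine the distribution of \<open>T\<close>.\<close>

definition realizes_cdf :: "real set \<Rightarrow> (real \<Rightarrow> real) \<Rightarrow> (real \<Rightarrow> real) \<Rightarrow> bool" where
  "realizes_cdf J G T \<longleftrightarrow> (\<forall>q\<in>\<rat>. G q \<le> measure M {x \<in> J. T x \<le> q} \<and> measure M {x \<in> J. T x < q} \<le> G q)"

lemma cluster_eq_floor: "\<delta> > 0 \<Longrightarrow> cluster \<delta> k = {x \<in> \<Omega>. \<lfloor>x / \<delta>\<rfloor> = k}"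
  by (auto simp: cluster_def floor_eq_iff field_simps)

lemma cluster_sets: "cluster \<delta> k \<in> sets M"
proof -
  have "{x \<in> space M. of_int k * \<delta> \<le> x \<and> x < of_int k * \<delta> + \<delta>} \<in> sets M"
    by measurable
  then show ?thesis
    by (simp add: cluster_def space_eq)
qed

lemma finite_clusters:
  assumes "\<delta> > 0"
  obtains K where "finite K" "\<And>x. x \<in> \<Omega> \<Longrightarrow> \<lfloor>x / \<delta>\<rfloor> \<in> K"
proof -
  obtain D where D: "\<And>x. x \<in> \<Omega> \<Longrightarrow> \<bar>x\<bar> \<le> D"
    using bounded_\<Omega> by (auto simp: bounded_iff)
  have "\<lfloor>x / \<delta>\<rfloor> \<in> {\<lfloor>- D / \<delta>\<rfloor>..\<lfloor>D / \<delta>\<rfloor>}" if "x \<in> \<Omega>" for x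
    using D[OF that] assms by (auto intro!: floor_mono simp: abs_le_iff field_simps)
  then show ?thesis
    using that[of "{\<lfloor>- D / \<delta>\<rfloor>..\<lfloor>D / \<delta>\<rfloor>}"] by blast
qed

lemma measure_eq_sum_clusters:
  assumes "\<delta> > 0" "finite K" "\<And>x. x \<in> \<Omega> \<Longrightarrow> \<lfloor>x / \<delta>\<rfloor> \<in> K" "Measurable.pred M P"
  shows "measure M {x \<in> \<Omega>. P x} = (\<Sum>k\<in>K. measure M {x \<in> cluster \<delta> k. P x})"
proof -
  have "{x \<in> \<Omega>. P x} = (\<Union>k\<in>K. {x \<in> cluster \<delta> k. P x})"
    using assms(3) by (auto simp: cluster_eq_floor[OF assms(1)])
  moreover have "disjoint_family_on (\<lambda>k. {x \<in> cluster \<delta> k. P x}) K"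
    by (auto simp: disjoint_family_on_def cluster_eq_floor[OF assms(1)])
  ultimately show ?thesis
    using sets_Collect_subset[OF cluster_sets assms(4)] assms(2)
    by (auto intro!: finite_measure_finite_Union)
qed

text \<open>Induction over the clusters. On a finished cluster both envelopes equal the new map, and
  the pair is still a relaxed map, so finished clusters constrain the later ones in the same way as
  untouched ones.\<close>

lemma replace_on_clusters:
  assumes "\<delta> > 0" "closed \<Omega>'" "\<Omega>' \<subseteq> {a..b}" "a \<le> b"
    and "finite K" "relaxed_map \<Omega>' \<delta> L l h"
    and "\<And>k. k \<in> K \<Longrightarrow> relaxed_cdf \<Omega>' a b (cluster \<delta> k) l h (G k)"
  shows "\<exists>l' h'. relaxed_map \<Omega>' \<delta> L l' h' \<and>
    (\<forall>k. k \<notin> K \<longrightarrow> (\<forall>x\<in>cluster \<delta> k. l' x = l x \<and> h' x = h x)) \<and>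
    (\<forall>k\<in>K. (\<forall>x\<in>cluster \<delta> k. l' x = h' x) \<and> realizes_cdf (cluster \<delta> k) (G k) h')"
  using assms(5,7)
proof (induction K rule: finite_induct)
  case empty
  then show ?case
    using assms(6) by blast
next
  case (insert k K)
  obtain l' h' where rel: "relaxed_map \<Omega>' \<delta> L l' h'"
    and same: "\<forall>i. i \<notin> K \<longrightarrow> (\<forall>x\<in>cluster \<delta> i. l' x = l x \<and> h' x = h x)"
    and processed: "\<forall>i\<in>K. (\<forall>x\<in>cluster \<delta> i. l' x = h' x) \<and> realizes_cdf (cluster \<delta> i) (G i) h'"
    using insert.IH insert.prems by blast
  let ?J = "cluster \<delta> k"
  have disj: "x \<notin> ?J" if "x \<in> cluster \<delta> i" "i \<noteq> k" for x i
    using that by (auto simp: cluster_eq_floor[OF assms(1)])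
  \<comment> \<open>The conditions on \<open>G k\<close> see the envelopes only on cluster
    \<open>k\<close>, which has not been modified yet.\<close>
  have sets_eq_J: "{x \<in> ?J. q \<le> h' x} = {x \<in> ?J. q \<le> h x}" "{x \<in> ?J. l' x \<le> q} = {x \<in> ?J. l x \<le> q}" for q
    using same insert.hyps(2) by auto
  have cdf: "relaxed_cdf \<Omega>' a b ?J l' h' (G k)"
    using insert.prems[of k] by (simp add: relaxed_cdf_def sets_eq_J)
  have meas[measurable]: "l' \<in> borel_measurable M" "h' \<in> borel_measurable M"
    and range: "\<And>x. x \<in> \<Omega> \<Longrightarrow> l' x \<in> \<Omega>' \<and> h' x \<in> \<Omega>' \<and> l' x \<le> h' x"
    and osc: "\<And>x x'. x \<in> \<Omega> \<Longrightarrow> x' \<in> \<Omega> \<Longrightarrow> \<bar>x - x'\<bar> < \<delta> \<Longrightarrow> h' x - l' x' \<le> L"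
    using rel by (auto simp: relaxed_map_def)
  obtain T where T[measurable]: "T \<in> borel_measurable M" and T\<Omega>': "\<And>x. x \<in> ?J \<Longrightarrow> T x \<in> \<Omega>'"
    and inside: "\<And>x y. x \<in> ?J \<Longrightarrow> y \<in> ?J \<Longrightarrow> T x - T y \<le> L"
    and outside: "\<And>x z. x \<in> ?J \<Longrightarrow> z \<in> \<Omega> - ?J \<Longrightarrow> \<bar>x - z\<bar> < \<delta> \<Longrightarrow> T x - l' z \<le> L \<and> h' z - T x \<le> L"
    and T_cdf: "\<And>q. q \<in> \<rat> \<Longrightarrow> G k q \<le> measure M {x \<in> ?J. T x \<le> q}"
      "\<And>q. q \<in> \<rat> \<Longrightarrow> measure M {x \<in> ?J. T x < q} \<le> G k q"
    by (rule cluster_step[of \<Omega>' a b l' h' \<delta> L "G k" "of_int k * \<delta>", folded cluster_def])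
       (use assms meas range osc cdf in \<open>auto simp: relaxed_cdf_def\<close>)
  have [measurable]: "?J \<in> sets M"
    by (rule cluster_sets)
  define l'' where "l'' x = (if x \<in> ?J then T x else l' x)" for x
  define h'' where "h'' x = (if x \<in> ?J then T x else h' x)" for x
  have "l'' \<in> borel_measurable M" "h'' \<in> borel_measurable M"
    unfolding l''_def h''_def by measurable
  moreover have "h'' x - l'' x' \<le> L" if "x \<in> \<Omega>" "x' \<in> \<Omega>" "\<bar>x - x'\<bar> < \<delta>" for x x'
    using inside[of x x'] outside[of x x'] outside[of x' x] osc[of x x'] that
    by (auto simp: l''_def h''_def abs_minus_commute)
  ultimately have "relaxed_map \<Omega>' \<delta> L l'' h''"
    using range T\<Omega>' by (auto simp: relaxed_map_def l''_def h''_def)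
  moreover have "l'' x = l x \<and> h'' x = h x" if "i \<notin> insert k K" "x \<in> cluster \<delta> i" for i x
    using same disj[OF that(2)] that by (auto simp: l''_def h''_def)
  moreover have "(\<forall>x\<in>cluster \<delta> i. l'' x = h'' x) \<and> realizes_cdf (cluster \<delta> i) (G i) h''" if "i \<in> insert k K" for i
  proof (cases "i = k")
    case True
    then have "{x \<in> cluster \<delta> i. h'' x \<le> q} = {x \<in> ?J. T x \<le> q}"
      "{x \<in> cluster \<delta> i. h'' x < q} = {x \<in> ?J. T x < q}" for q
      by (auto simp: h''_def)
    then show ?thesis
      using True T_cdf by (simp add: l''_def h''_def realizes_cdf_def)
  next
    case False
    then have eq: "h'' x = h' x" "l'' x = l' x" if "x \<in> cluster \<delta> i" for x
      using disj[OF that] by (auto simp: l''_def h''_def)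
    have "{x \<in> cluster \<delta> i. h'' x \<le> q} = {x \<in> cluster \<delta> i. h' x \<le> q}"
      "{x \<in> cluster \<delta> i. h'' x < q} = {x \<in> cluster \<delta> i. h' x < q}" for q
      using eq by auto
    then show ?thesis
      using processed that False eq by (auto simp: realizes_cdf_def)
  qed
  ultimately show ?case
    by blast
qed

section \<open>From distribution functions at rationals to transport maps\<close>

lemma right_cont_rational_below:
  fixes f :: "real \<Rightarrow> real"
  assumes "continuous (at_right t) f" "f t < c"
  obtains q where "q \<in> \<rat>" "t < q" "f q < c"
proof -
  have "eventually (\<lambda>s. f s < c) (at_right t)"
    using assms by (intro order_tendstoD(2)) (auto simp: continuous_within)
  then obtain e where e: "e > t" "\<And>s. t < s \<Longrightarrow> s < e \<Longrightarrow> f s < c"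
    by (auto simp: eventually_at_right_field)
  obtain q where "q \<in> \<rat>" "t < q" "q < e"
    using Rats_dense_in_real[OF e(1)] by blast
  then show ?thesis
    using that e(2) by blast
qed

text \<open>For \<open>t < q\<close> with \<open>q\<close> rational, the mass of
  \<open>T x \<le> t\<close> is at most that of \<open>T x < q\<close>, so the hypotheses sandwich
  the two distribution functions between rationals; right-continuity makes them equal, and they
  determine the laws.\<close>

lemma distr_eq_of_rational_cdf:
  fixes T :: "real \<Rightarrow> real"
  assumes N: "N \<in> prob_measures_on \<Omega>'" and T[measurable]: "T \<in> measurable M N"
    and "closed \<Omega>'"
    and le: "\<And>q. q \<in> \<rat> \<Longrightarrow> measure N {y \<in> \<Omega>'. y \<le> q} \<le> measure M {x \<in> \<Omega>. T x \<le> q}"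
    and less: "\<And>q. q \<in> \<rat> \<Longrightarrow> measure M {x \<in> \<Omega>. T x < q} \<le> measure N {y \<in> \<Omega>'. y \<le> q}"
  shows "distr M N T = N"
proof -
  interpret N: prob_space N
    using N by (simp add: prob_measures_on_def)
  have sets_N: "sets N = sets (restrict_space borel \<Omega>')"
    using N by (simp add: prob_measures_on_def)
  have space_N: "space N = \<Omega>'"
    using sets_eq_imp_space_eq[OF sets_N] by (simp add: space_restrict_space)
  have id_N[measurable]: "(\<lambda>y. y) \<in> borel_measurable N"
    by (rule measurable_ident_restrict[OF sets_N])
  have T_borel[measurable]: "T \<in> borel_measurable M"
    using measurable_compose[OF T id_N] by simp
  interpret A: real_distribution "distr M borel T"
    by (rule real_distribution_distr) measurable
  interpret B: real_distribution "distr N borel (\<lambda>y. y)"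
    by (rule N.real_distribution_distr) measurable
  have cdf_A: "cdf (distr M borel T) t = measure M {x \<in> \<Omega>. T x \<le> t}" for t
    by (simp add: cdf_def2 measure_distr vimage_def space_eq Int_def conj_commute)
  have cdf_B: "cdf (distr N borel (\<lambda>y. y)) t = measure N {y \<in> \<Omega>'. y \<le> t}" for t
    by (simp add: cdf_def2 measure_distr vimage_def space_N Int_def conj_commute)
  have A_le_B: "cdf (distr M borel T) t \<le> cdf (distr N borel (\<lambda>y. y)) q" if "t < q" "q \<in> \<rat>" for t q
  proof -
    have "{x \<in> space M. T x < q} \<in> sets M"
      by measurable
    then have "measure M {x \<in> \<Omega>. T x \<le> t} \<le> measure M {x \<in> \<Omega>. T x < q}"
      using that(1) by (intro finite_measure_mono) (auto simp: space_eq)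
    then show ?thesis
      using less[OF that(2)] by (simp add: cdf_A cdf_B)
  qed
  have "cdf (distr M borel T) t = cdf (distr N borel (\<lambda>y. y)) t" for t
  proof (rule antisym; rule ccontr)
    assume "\<not> cdf (distr M borel T) t \<le> cdf (distr N borel (\<lambda>y. y)) t"
    then obtain q where "q \<in> \<rat>" "t < q" "cdf (distr N borel (\<lambda>y. y)) q < cdf (distr M borel T) t"
      using right_cont_rational_below[OF B.cdf_is_right_cont] by (metis not_le)
    then show False
      using A_le_B[of t q] by linarith
  next
    assume "\<not> cdf (distr N borel (\<lambda>y. y)) t \<le> cdf (distr M borel T) t"
    then obtain q where q: "q \<in> \<rat>" "t < q" "cdf (distr M borel T) q < cdf (distr N borel (\<lambda>y. y)) t"
      using right_cont_rational_below[OF A.cdf_is_right_cont] by (metis not_le)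
    then show False
      using le[OF q(1)] B.cdf_nondecreasing[of t q] by (simp add: cdf_A cdf_B)
  qed
  then have eq: "distr M borel T = distr N borel (\<lambda>y. y)"
    by (intro cdf_unique ext) (auto intro: A.real_distribution_axioms B.real_distribution_axioms)
  show ?thesis
  \<comment> \<open>Back from laws on the whole line to \<open>N\<close>: as
    \<open>\<Omega>'\<close> is closed, the measurable sets of \<open>N\<close> are Borel
    sets.\<close>
  proof (rule measure_eqI)
    fix A assume "A \<in> sets (distr M N T)"
    then have A: "A \<in> sets N"
      by simp
    then have "A \<subseteq> \<Omega>'" "A \<in> sets borel"
      using sets.sets_into_space[OF A] \<open>closed \<Omega>'\<close>
      by (auto simp: space_N sets_N sets_restrict_space_iff)
    have "emeasure (distr M N T) A = emeasure (distr M borel T) A"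
      using A \<open>A \<in> sets borel\<close> by (simp add: emeasure_distr)
    also have "\<dots> = emeasure N ((\<lambda>y. y) -` A \<inter> space N)"
      unfolding eq using \<open>A \<in> sets borel\<close> by (simp add: emeasure_distr)
    also have "(\<lambda>y. y) -` A \<inter> space N = A"
      using \<open>A \<subseteq> \<Omega>'\<close> by (auto simp: space_N)
    finally show "emeasure (distr M N T) A = emeasure N A" .
  qed simp
qed

text \<open>\<open>K\<close> covers \<open>\<Omega>\<close>, so after all replacements the two
  envelopes coincide there and the oscillation bound becomes two-sided. Summing the cluster
  inequalities over \<open>K\<close> gives those for the distribution function of
  \<open>N\<close>.\<close>

lemma transport_map_of_relaxed_map:
  assumes "\<delta> > 0" "closed \<Omega>'" "\<Omega>' \<subseteq> {a..b}" "a \<le> b" "N \<in> prob_measures_on \<Omega>'"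
    and "finite K" "\<And>x. x \<in> \<Omega> \<Longrightarrow> \<lfloor>x / \<delta>\<rfloor> \<in> K"
    and "relaxed_map \<Omega>' \<delta> L l h"
    and "\<And>k. k \<in> K \<Longrightarrow> relaxed_cdf \<Omega>' a b (cluster \<delta> k) l h (G k)"
    and sum_G: "\<And>q. q \<in> \<rat> \<Longrightarrow> (\<Sum>k\<in>K. G k q) = measure N {y \<in> \<Omega>'. y \<le> q}"
  shows "\<exists>T \<in> transport_maps M N. \<forall>x\<in>\<Omega>. \<forall>x'\<in>\<Omega>. \<bar>x - x'\<bar> < \<delta> \<longrightarrow> \<bar>T x - T x'\<bar> \<le> L"
proof -
  obtain l' T where rel: "relaxed_map \<Omega>' \<delta> L l' T"
    and T_K: "\<forall>k\<in>K. (\<forall>x\<in>cluster \<delta> k. l' x = T x) \<and> realizes_cdf (cluster \<delta> k) (G k) T"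
    using replace_on_clusters[OF assms(1-4,6,8,9)] by blast
  have cdf: "G k q \<le> measure M {x \<in> cluster \<delta> k. T x \<le> q}"
    "measure M {x \<in> cluster \<delta> k. T x < q} \<le> G k q" if "k \<in> K" "q \<in> \<rat>" for k q
    using T_K that by (auto simp: realizes_cdf_def)
  have eq: "l' x = T x" if "x \<in> \<Omega>" for x
    using T_K assms(7)[OF that] that by (simp add: cluster_eq_floor[OF assms(1)])
  have T[measurable]: "T \<in> borel_measurable M" and T\<Omega>': "\<And>x. x \<in> \<Omega> \<Longrightarrow> T x \<in> \<Omega>'"
    and osc: "\<And>x x'. x \<in> \<Omega> \<Longrightarrow> x' \<in> \<Omega> \<Longrightarrow> \<bar>x - x'\<bar> < \<delta> \<Longrightarrow> T x - T x' \<le> L"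
    using rel eq by (auto simp: relaxed_map_def)
  have "T \<in> measurable M (restrict_space borel \<Omega>')"
    using T T\<Omega>' by (intro measurable_restrict_space2) (auto simp: space_eq)
  then have T_N: "T \<in> measurable M N"
    using assms(5) by (subst measurable_cong_sets[OF refl]) (auto simp: prob_measures_on_def)
  have "distr M N T = N"
  proof (rule distr_eq_of_rational_cdf[OF assms(5) T_N assms(2)])
    fix q :: real assume q: "q \<in> \<rat>"
    show "measure N {y \<in> \<Omega>'. y \<le> q} \<le> measure M {x \<in> \<Omega>. T x \<le> q}"
      by (subst measure_eq_sum_clusters[OF assms(1,6,7)])
         (auto simp: sum_G[OF q, symmetric] cdf q intro!: sum_mono)
    show "measure M {x \<in> \<Omega>. T x < q} \<le> measure N {y \<in> \<Omega>'. y \<le> q}"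
      by (subst measure_eq_sum_clusters[OF assms(1,6,7)])
         (auto simp: sum_G[OF q, symmetric] cdf q intro!: sum_mono)
  qed
  moreover have "\<bar>T x - T x'\<bar> \<le> L" if "x \<in> \<Omega>" "x' \<in> \<Omega>" "\<bar>x - x'\<bar> < \<delta>" for x x'
    using osc[OF that] osc[of x' x] that by (auto simp: abs_minus_commute abs_le_iff)
  ultimately show ?thesis
    using T_N by (auto simp: transport_maps_def)
qed

section \<open>Envelopes of a sequence of maps\<close>

text \<open>Rational endpoints give a countable base of \<open>\<Omega>\<close>, so one subsequence
  can serve all windows.\<close>

definition window :: "rat \<times> rat \<Rightarrow> real set" where
  "window i = \<Omega> \<inter> {of_rat (fst i)<..<of_rat (snd i)}"

text \<open>When \<open>S i\<close> is the limit of the suprema of \<open>g n\<close> over window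
  \<open>i\<close>, this is the relaxed upper limit of the sequence: the upper limit of
  \<open>g n y\<close> as \<open>n\<close> tends to infinity and \<open>y\<close> tends to
  \<open>x\<close> jointly.\<close>

definition upper_envelope :: "(rat \<times> rat \<Rightarrow> real) \<Rightarrow> real \<Rightarrow> real" where
  "upper_envelope S x = Inf (S ` {i. x \<in> window i})"

lemma window_sets: "window i \<in> sets M"
proof -
  have "{x \<in> space M. of_rat (fst i) < x \<and> x < of_rat (snd i)} \<in> sets M"
    by measurable
  moreover have "window i = {x \<in> space M. of_rat (fst i) < x \<and> x < of_rat (snd i)}"
    by (auto simp: window_def space_eq)
  ultimately show ?thesis
    by simp
qed

lemma small_window:
  assumes "x \<in> \<Omega>" "e > 0"
  obtains i where "x \<in> window i" "\<And>y. y \<in> window i \<Longrightarrow> \<bar>y - x\<bar> < e"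
proof -
  obtain u where u: "x - e < of_rat u" "of_rat u < x"
    using of_rat_dense[of "x - e" x] assms(2) by auto
  obtain v where v: "x < of_rat v" "of_rat v < x + e"
    using of_rat_dense[of x "x + e"] assms(2) by auto
  show ?thesis
    using that[of "(u, v)"] u v assms(1) by (auto simp: window_def abs_less_iff)
qed

lemma Sup_window_in:
  fixes f :: "real \<Rightarrow> real"
  assumes "closed Y" "Y \<subseteq> {a..b}" "\<And>x. x \<in> \<Omega> \<Longrightarrow> f x \<in> Y" "window i \<noteq> {}"
  shows "Sup (f ` window i) \<in> Y"
proof (rule closed_subset_contains_Sup[OF assms(1)])
  show "f ` window i \<subseteq> Y"
    using assms(3) by (auto simp: window_def)
  then show "bdd_above (f ` window i)"
    using assms(2) by (intro bdd_aboveI[of _ b]) force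
qed (use assms(4) in simp)

context
  fixes Y :: "real set" and a b :: real and g :: "nat \<Rightarrow> real \<Rightarrow> real" and S :: "rat \<times> rat \<Rightarrow> real"
  assumes Y: "closed Y" "Y \<subseteq> {a..b}"
    and g: "\<And>n x. x \<in> \<Omega> \<Longrightarrow> g n x \<in> Y"
    and S: "\<And>i. window i \<noteq> {} \<Longrightarrow> (\<lambda>n. Sup (g n ` window i)) \<longlonglongrightarrow> S i"
begin

lemma bdd_above_window_image: "bdd_above (g n ` window i)"
  using g Y(2) by (intro bdd_aboveI[of _ b]) (force simp: window_def)

lemma window_limit_in: "window i \<noteq> {} \<Longrightarrow> S i \<in> Y"
  by (rule closed_sequentially[OF Y(1) _ S]) (rule Sup_window_in[OF Y g])

lemma windows_nonempty: "x \<in> \<Omega> \<Longrightarrow> S ` {i. x \<in> window i} \<noteq> {}"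
  using small_window[of x 1] by (metis empty_is_image mem_Collect_eq equals0D zero_less_one)

lemma windows_bdd: "bdd_below (S ` {i. x \<in> window i})"
  using window_limit_in Y(2) by (intro bdd_belowI[of _ a]) force

lemma upper_envelope_le: "x \<in> window i \<Longrightarrow> upper_envelope S x \<le> S i"
  using windows_bdd by (subst upper_envelope_def) (auto simp: window_def[of i] intro!: cInf_lower)

lemma upper_envelope_ge: "x \<in> \<Omega> \<Longrightarrow> (\<And>i. x \<in> window i \<Longrightarrow> c \<le> S i) \<Longrightarrow> c \<le> upper_envelope S x"
  using windows_nonempty[of x] by (subst upper_envelope_def) (auto intro!: cInf_greatest)

lemma upper_envelope_in: "x \<in> \<Omega> \<Longrightarrow> upper_envelope S x \<in> Y"
  using windows_nonempty[of x] windows_bdd[of x] window_limit_in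
  by (subst upper_envelope_def) (auto intro!: closed_subset_contains_Inf[OF Y(1)])

text \<open>An infimum is below \<open>t\<close> iff one of its members is. The union is countable,
  which yields measurability and an exhaustion by finite unions.\<close>

lemma upper_envelope_less:
  "{x \<in> \<Omega>. upper_envelope S x < t} = (\<Union>i\<in>{i. S i < t}. window i)"
proof (intro equalityI subsetI)
  fix x assume x: "x \<in> {x \<in> \<Omega>. upper_envelope S x < t}"
  then have "\<exists>s\<in>S ` {i. x \<in> window i}. s < t"
    using windows_nonempty[of x] by (intro cInf_lessD) (auto simp: upper_envelope_def)
  then show "x \<in> (\<Union>i\<in>{i. S i < t}. window i)"
    by auto
next
  fix x assume "x \<in> (\<Union>i\<in>{i. S i < t}. window i)"
  then obtain i where "S i < t" "x \<in> window i"
    by auto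
  then show "x \<in> {x \<in> \<Omega>. upper_envelope S x < t}"
    using upper_envelope_le[of x i] by (auto simp: window_def)
qed

lemma upper_envelope_measurable: "upper_envelope S \<in> borel_measurable M"
proof (subst borel_measurable_iff_less, rule allI)
  fix t
  have "(\<Union>i\<in>{i. S i < t}. window i) \<in> sets M"
    by (rule sets.countable_UN'') (auto intro: window_sets)
  then show "{x \<in> space M. upper_envelope S x < t} \<in> sets M"
    by (simp add: space_eq upper_envelope_less)
qed

text \<open>On a window with \<open>S i < q\<close>, eventually \<open>g n x < q\<close> throughout.
  Hence the sets \<open>q \<le> g n x\<close> eventually avoid any finite union of such windows, and
  these unions exhaust the part of \<open>\<Omega>\<close> where the envelope is below
  \<open>q\<close>.\<close>

lemma upper_envelope_measure:
  assumes J: "J \<in> sets M" and g_meas: "\<And>n. g n \<in> borel_measurable M"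
    and c: "\<And>n. c n \<le> measure M {x \<in> J. q \<le> g n x}" "c \<longlonglongrightarrow> c'"
  shows "c' \<le> measure M {x \<in> J. q \<le> upper_envelope S x}"
proof -
  \<comment> \<open>Only finitely many windows enter \<open>A m\<close>, so their eventual bounds
    hold from a common index on.\<close>
  define A where "A m = (\<Union>i\<in>{i. S i < q \<and> to_nat i < m}. window i)" for m :: nat
  have fin: "finite {i. S i < q \<and> to_nat i < m}" for m :: nat
    by (rule finite_subset[OF _ finite_vimageI[OF finite_lessThan[of m] inj_to_nat]]) auto
  have A: "A m \<in> sets M" for m
    unfolding A_def using fin window_sets by (intro sets.finite_UN) auto
  have "J \<subseteq> \<Omega>"
    using sets.sets_into_space[OF J] by (simp add: space_eq)
  have "c' \<le> measure M (J - A m)" for m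
  proof (rule LIMSEQ_le_const2[OF c(2)])
    have "\<forall>i\<in>{i. S i < q \<and> to_nat i < m}. \<forall>\<^sub>F n in sequentially. \<forall>x\<in>window i. g n x < q"
    proof safe
      fix i assume "S i < q"
      show "\<forall>\<^sub>F n in sequentially. \<forall>x\<in>window i. g n x < q"
      proof (cases "window i = {}")
        case False
        from order_tendstoD(2)[OF S[OF False] \<open>S i < q\<close>] show ?thesis
          by eventually_elim (metis bdd_above_window_image cSUP_upper order.strict_trans1)
      qed simp
    qed
    then have "\<forall>\<^sub>F n in sequentially. \<forall>i\<in>{i. S i < q \<and> to_nat i < m}. \<forall>x\<in>window i. g n x < q"
      by (rule eventually_ball_finite[OF fin])
    then have "\<forall>\<^sub>F n in sequentially. c n \<le> measure M (J - A m)"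
    proof eventually_elim
      case (elim n)
      then have "{x \<in> J. q \<le> g n x} \<subseteq> J - A m"
        by (force simp: A_def)
      then have "measure M {x \<in> J. q \<le> g n x} \<le> measure M (J - A m)"
        using J A by (intro finite_measure_mono) auto
      then show ?case
        using c(1)[of n] by linarith
    qed
    then show "\<exists>n0. \<forall>n\<ge>n0. c n \<le> measure M (J - A m)"
      by (simp add: eventually_sequentially)
  qed
  moreover have "(\<lambda>m. measure M (J - A m)) \<longlonglongrightarrow> measure M (\<Inter>m. J - A m)"
    using J A by (intro finite_Lim_measure_decseq) (auto simp: decseq_def A_def)
  moreover have "(\<Inter>m. J - A m) = {x \<in> J. q \<le> upper_envelope S x}"
  proof -
    have "(\<Union>m. A m) = {x \<in> \<Omega>. upper_envelope S x < q}"
      unfolding upper_envelope_less A_def by auto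
    then show ?thesis
      using \<open>J \<subseteq> \<Omega>\<close> by (auto simp: set_eq_iff not_less)
  qed
  ultimately show ?thesis
    by (auto intro: LIMSEQ_le_const)
qed

end

section \<open>Existence of an optimal map\<close>

text \<open>The maps themselves need not converge, but their window suprema and cluster distribution
  functions do along a subsequence; the limits form a relaxed map with compatible distribution
  functions, which is then turned into a map.\<close>

lemma limit_transport_map:
  fixes T :: "nat \<Rightarrow> real \<Rightarrow> real"
  assumes "\<delta> > 0" "closed \<Omega>'" "\<Omega>' \<subseteq> {a..b}" "N \<in> prob_measures_on \<Omega>'"
    and T: "\<And>n. T n \<in> transport_maps M N"
    and osc: "\<And>n x x'. x \<in> \<Omega> \<Longrightarrow> x' \<in> \<Omega> \<Longrightarrow> \<bar>x - x'\<bar> < \<delta> \<Longrightarrow> \<bar>T n x - T n x'\<bar> \<le> c n"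
    and "c \<longlonglongrightarrow> L"
  shows "\<exists>T \<in> transport_maps M N. \<forall>x\<in>\<Omega>. \<forall>x'\<in>\<Omega>. \<bar>x - x'\<bar> < \<delta> \<longrightarrow> \<bar>T x - T x'\<bar> \<le> L"
proof -
  have sets_N: "sets N = sets (restrict_space borel \<Omega>')"
    using assms(4) by (simp add: prob_measures_on_def)
  have space_N: "space N = \<Omega>'"
    using sets_eq_imp_space_eq[OF sets_N] by (simp add: space_restrict_space)
  have T_N: "T n \<in> measurable M N" and T_distr: "distr M N (T n) = N" for n
    using T by (auto simp: transport_maps_def)
  have T_meas[measurable]: "T n \<in> borel_measurable M" for n
    using measurable_compose[OF T_N measurable_ident_restrict[OF sets_N]] by simp
  have T_in: "T n x \<in> \<Omega>'" if "x \<in> \<Omega>" for n x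
    using measurable_space[OF T_N] that by (simp add: space_eq space_N)
  then have T_ab: "a \<le> T n x" "T n x \<le> b" if "x \<in> \<Omega>" for n x
    using assms(3) that by (meson atLeastAtMost_iff subsetD)+
  obtain x0 where "x0 \<in> \<Omega>"
    using not_empty by (auto simp: space_eq)
  then have "a \<le> b"
    using T_ab[of x0 0] by linarith
  \<comment> \<open>The lower envelope is obtained as minus the upper envelope of the negated maps,
    which take values in \<open>Y\<close>.\<close>
  define Y where "Y = uminus ` \<Omega>'"
  have Y: "closed Y" "Y \<subseteq> {-b..-a}"
    using assms(2,3) by (auto simp: Y_def closed_negations)
  have negT_in: "- T n x \<in> Y" if "x \<in> \<Omega>" for n x
    using T_in[OF that] by (simp add: Y_def)
  have Sup_T: "Sup (T n ` window i) \<in> \<Omega>'" and Sup_negT: "Sup ((\<lambda>x. - T n x) ` window i) \<in> Y"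
    if "window i \<noteq> {}" for n i
    using Sup_window_in[OF assms(2,3) T_in that] Sup_window_in[OF Y negT_in that] by auto
  \<comment> \<open>All quantities that must converge, bundled over one countable index type; the
    value \<open>0\<close> on empty windows keeps the family bounded.\<close>
  define f where "f n = case_sum
      (case_sum (\<lambda>i. if window i = {} then 0 else Sup (T n ` window i))
        (\<lambda>i. if window i = {} then 0 else Sup ((\<lambda>x. - T n x) ` window i)))
      (\<lambda>(k, q). measure M {x \<in> cluster \<delta> k. T n x \<le> of_rat q})" for n
  have "\<bar>f n j\<bar> \<le> 1 + \<bar>a\<bar> + \<bar>b\<bar>" for n j
  proof -
    have "\<bar>Sup (T n ` window i)\<bar> \<le> 1 + \<bar>a\<bar> + \<bar>b\<bar>" if "window i \<noteq> {}" for i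
      using subsetD[OF assms(3) Sup_T[OF that, of n]] by auto
    moreover have "\<bar>Sup ((\<lambda>x. - T n x) ` window i)\<bar> \<le> 1 + \<bar>a\<bar> + \<bar>b\<bar>" if "window i \<noteq> {}" for i
      using subsetD[OF Y(2) Sup_negT[OF that, of n]] by auto
    moreover have "measure M {x \<in> cluster \<delta> k. T n x \<le> of_rat q} \<le> 1 + \<bar>a\<bar> + \<bar>b\<bar>" for k q
      using prob_le_1[of "{x \<in> cluster \<delta> k. T n x \<le> of_rat q}"] by linarith
    ultimately show ?thesis
      by (auto simp: f_def split: sum.split)
  qed
  then obtain r where r: "strict_mono r" "\<And>j. convergent (\<lambda>n. f (r n) j)"
    using countable_family_convergent_subseq[of f] by blast
  define g where "g n = T (r n)" for n
  define S where "S i = lim (\<lambda>n. Sup (g n ` window i))" for i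
  define S' where "S' i = lim (\<lambda>n. Sup ((\<lambda>x. - g n x) ` window i))" for i
  define G where "G k q = lim (\<lambda>n. measure M {x \<in> cluster \<delta> k. g n x \<le> q})" for k q
  have S: "(\<lambda>n. Sup (g n ` window i)) \<longlonglongrightarrow> S i"
    and S': "(\<lambda>n. Sup ((\<lambda>x. - g n x) ` window i)) \<longlonglongrightarrow> S' i" if "window i \<noteq> {}" for i
    using r(2)[of "Inl (Inl i)"] r(2)[of "Inl (Inr i)"] that
    by (auto simp: f_def S_def S'_def g_def convergent_LIMSEQ_iff)
  have G: "(\<lambda>n. measure M {x \<in> cluster \<delta> k. g n x \<le> q}) \<longlonglongrightarrow> G k q" if q: "q \<in> \<rat>" for k q
  proof -
    obtain q' where "q = of_rat q'"
      using q by (auto elim: Rats_cases)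
    then show ?thesis
      using r(2)[of "Inr (k, q')"] by (simp add: f_def G_def g_def convergent_LIMSEQ_iff)
  qed
  have g_in: "\<And>n x. x \<in> \<Omega> \<Longrightarrow> g n x \<in> \<Omega>'" and neg_g_in: "\<And>n x. x \<in> \<Omega> \<Longrightarrow> - g n x \<in> Y"
    using T_in negT_in by (auto simp: g_def)
  have g_meas[measurable]: "g n \<in> borel_measurable M" for n
    by (simp add: g_def)
  note env = assms(2,3) g_in S and env' = Y neg_g_in S'
  define h where "h = upper_envelope S"
  define l where "l x = - upper_envelope S' x" for x
  have sets_g: "{x \<in> cluster \<delta> k. g n x \<le> q} \<in> sets M" "{x \<in> cluster \<delta> k. q < g n x} \<in> sets M"
    "{x \<in> cluster \<delta> k. q \<le> g n x} \<in> sets M" for k n q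
    by (intro sets_Collect_subset[OF cluster_sets]; measurable)+
  have bdd: "bdd_above (g n ` window i)" "bdd_above ((\<lambda>x. - g n x) ` window i)" for n i
    by (rule bdd_above_window_image[OF env]; assumption) (rule bdd_above_window_image[OF env']; assumption)
  have windows_le: "C \<le> S i + S' j"
    if "x \<in> window i" "x' \<in> window j" "\<And>n. C \<le> g n x - g n x'" for C i j x x'
  proof (rule LIMSEQ_le_const[OF tendsto_add[OF S S']])
    have "C \<le> Sup (g n ` window i) + Sup ((\<lambda>x. - g n x) ` window j)" for n
      using cSUP_upper[OF that(1) bdd(1)[of n]] cSUP_upper[OF that(2) bdd(2)[of n]] that(3)[of n] by linarith
    then show "\<exists>m. \<forall>n\<ge>m. C \<le> Sup (g n ` window i) + Sup ((\<lambda>x. - g n x) ` window j)"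
      by blast
  qed (use that in auto)
  \<comment> \<open>Two windows \<open>i\<close> and \<open>j\<close> around \<open>x\<close> share
    the point \<open>x\<close>, so \<open>0 \<le> S i + S' j\<close>.\<close>
  have l_le_h: "l x \<le> h x" if x: "x \<in> \<Omega>" for x
  proof -
    have "- S' j \<le> h x" if "x \<in> window j" for j
      unfolding h_def using windows_le[OF _ that, of x _ 0]
      by (intro upper_envelope_ge[OF env] x) force+
    then show ?thesis
      unfolding l_def using upper_envelope_ge[OF env' x, of "- h x"] by force
  qed
  have h_l: "h x - l x' \<le> L" if x: "x \<in> \<Omega>" "x' \<in> \<Omega>" "\<bar>x - x'\<bar> < \<delta>" for x x'
  proof -
    \<comment> \<open>Half the slack in the strict inequality: points of windows of radius
      \<open>e\<close> around \<open>x\<close> and \<open>x'\<close> are still closer than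
      \<delta>.\<close>
    define e where "e = (\<delta> - \<bar>x - x'\<bar>) / 2"
    have "e > 0"
      using x(3) by (simp add: e_def)
    obtain i where i: "x \<in> window i" "\<And>y. y \<in> window i \<Longrightarrow> \<bar>y - x\<bar> < e"
      using small_window[OF x(1) \<open>e > 0\<close>] by blast
    obtain j where j: "x' \<in> window j" "\<And>y. y \<in> window j \<Longrightarrow> \<bar>y - x'\<bar> < e"
      using small_window[OF x(2) \<open>e > 0\<close>] by blast
    have "g n y - g n y' \<le> c (r n)" if "y \<in> window i" "y' \<in> window j" for n y y'
    proof -
      have "\<bar>y - y'\<bar> < \<delta>"
        using i(2)[OF that(1)] j(2)[OF that(2)] by (simp add: e_def abs_if split: if_splits)
      then show ?thesis
        using osc[of y y' "r n"] that by (auto simp: window_def g_def)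
    qed
    then have "g n y \<le> c (r n) - Sup ((\<lambda>x. - g n x) ` window j)" if "y \<in> window i" for n y
    proof -
      have "Sup ((\<lambda>x. - g n x) ` window j) \<le> c (r n) - g n y"
        using j(1) \<open>\<And>y y' n. y \<in> window i \<Longrightarrow> y' \<in> window j \<Longrightarrow> g n y - g n y' \<le> c (r n)\<close> that
        by (intro cSUP_least) (auto simp: algebra_simps)
      then show ?thesis
        by simp
    qed
    then have "Sup (g n ` window i) \<le> c (r n) - Sup ((\<lambda>x. - g n x) ` window j)" for n
      using i(1) by (intro cSUP_least) auto
    then have "Sup (g n ` window i) + Sup ((\<lambda>x. - g n x) ` window j) \<le> c (r n)" for n
      by (simp add: algebra_simps)
    moreover have "(\<lambda>n. c (r n)) \<longlonglongrightarrow> L"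
      using LIMSEQ_subseq_LIMSEQ[OF assms(7) r(1)] by (simp add: o_def)
    ultimately have "S i + S' j \<le> L"
      using i(1) j(1) by (intro LIMSEQ_le[OF tendsto_add[OF S S']]) auto
    moreover have "h x \<le> S i" "- l x' \<le> S' j"
      using upper_envelope_le[OF env i(1)] upper_envelope_le[OF env' j(1)] by (auto simp: h_def l_def)
    ultimately show ?thesis
      by linarith
  qed
  have rel: "relaxed_map \<Omega>' \<delta> L l h"
  proof -
    have [measurable]: "upper_envelope S \<in> borel_measurable M" "upper_envelope S' \<in> borel_measurable M"
      using upper_envelope_measurable[OF env] upper_envelope_measurable[OF env'] by auto
    have "l \<in> borel_measurable M" "h \<in> borel_measurable M"
      unfolding l_def h_def by measurable
    moreover have "l x \<in> \<Omega>'" "h x \<in> \<Omega>'" if "x \<in> \<Omega>" for x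
      using upper_envelope_in[OF env that] upper_envelope_in[OF env' that]
      by (auto simp: l_def h_def Y_def)
    ultimately show ?thesis
      using l_le_h h_l by (auto simp: relaxed_map_def)
  qed
  have cdf: "relaxed_cdf \<Omega>' a b (cluster \<delta> k) l h (G k)" for k
    unfolding relaxed_cdf_def
  proof (intro conjI ballI impI)
    let ?J = "cluster \<delta> k"
    have J\<Omega>: "?J \<subseteq> \<Omega>"
      by (auto simp: cluster_def)
    fix q :: real assume q: "q \<in> \<rat>"
    show "0 \<le> G k q"
      by (rule LIMSEQ_le_const[OF G[OF q]]) simp
    show "G k q \<le> measure M ?J"
      by (rule LIMSEQ_le_const2[OF G[OF q]]) (auto intro!: finite_measure_mono cluster_sets)
    show "G k q = 0" if "q < a"
    proof -
      have "\<not> g n x \<le> q" if "x \<in> ?J" for n x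
        using T_ab(1)[of x "r n"] that J\<Omega> \<open>q < a\<close> by (auto simp: g_def)
      then have empty: "{x \<in> ?J. g n x \<le> q} = {}" for n
        by auto
      show ?thesis
        using G[OF q, of k] by (simp only: empty measure_empty LIMSEQ_const_iff)
    qed
    show "G k q = measure M ?J" if "b \<le> q"
    proof -
      have "g n x \<le> q" if "x \<in> ?J" for n x
        using T_ab(2)[of x "r n"] that J\<Omega> \<open>b \<le> q\<close> by (auto simp: g_def)
      then have "{x \<in> ?J. g n x \<le> q} = ?J" for n
        by auto
      then show ?thesis
        using G[OF q, of k] LIMSEQ_unique[OF _ tendsto_const] by simp
    qed
    show "G k q \<le> G k q'" if "q' \<in> \<rat>" "q \<le> q'" for q'
      by (rule LIMSEQ_le[OF G[OF q] G[OF that(1)]])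
         (use that(2) in \<open>auto intro!: finite_measure_mono sets_g\<close>)
    show "G k t \<le> G k q" if "t \<in> \<rat>" "q < t" "{q<..t} \<inter> \<Omega>' = {}" for t
    proof (rule LIMSEQ_le[OF G[OF that(1)] G[OF q]])
      have "{x \<in> ?J. g n x \<le> t} \<subseteq> {x \<in> ?J. g n x \<le> q}" for n
        using g_in J\<Omega> that(3) by (force simp: not_le)
      then show "\<exists>m. \<forall>n\<ge>m. measure M {x \<in> ?J. g n x \<le> t} \<le> measure M {x \<in> ?J. g n x \<le> q}"
        using sets_g by (blast intro: finite_measure_mono)
    qed
    show "measure M ?J - G k q \<le> measure M {x \<in> ?J. q \<le> h x}"
      unfolding h_def
    proof (rule upper_envelope_measure[OF env])
      show "measure M ?J - measure M {x \<in> ?J. g n x \<le> q} \<le> measure M {x \<in> ?J. q \<le> g n x}" for n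
      proof -
        have "measure M ?J - measure M {x \<in> ?J. g n x \<le> q} = measure M (?J - {x \<in> ?J. g n x \<le> q})"
          using sets_g cluster_sets by (subst finite_measure_Diff) auto
        also have "\<dots> \<le> measure M {x \<in> ?J. q \<le> g n x}"
          using sets_g by (intro finite_measure_mono) auto
        finally show ?thesis .
      qed
      show "(\<lambda>n. measure M ?J - measure M {x \<in> ?J. g n x \<le> q}) \<longlonglongrightarrow> measure M ?J - G k q"
        by (intro tendsto_intros G q)
    qed (auto intro: cluster_sets)
    \<comment> \<open>The same bound for the negated maps at level \<open>- q\<close>, since
      \<open>g n x \<le> q\<close> means \<open>- q \<le> - g n x\<close>.\<close>
    have "G k q \<le> measure M {x \<in> ?J. - q \<le> upper_envelope S' x}"
      by (rule upper_envelope_measure[OF env' _ _ _ G[OF q]]) (auto intro: cluster_sets)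
    then show "G k q \<le> measure M {x \<in> ?J. l x \<le> q}"
      by (simp add: l_def minus_le_iff)
  qed
  obtain K where K: "finite K" "\<And>x. x \<in> \<Omega> \<Longrightarrow> \<lfloor>x / \<delta>\<rfloor> \<in> K"
    using finite_clusters[OF assms(1)] by blast
  \<comment> \<open>Each \<open>g n\<close> transports to \<open>N\<close>, so the cluster masses
    have this sum for every \<open>n\<close>, and the finite sum passes to the limit.\<close>
  have "(\<Sum>k\<in>K. G k q) = measure N {y \<in> \<Omega>'. y \<le> q}" if q: "q \<in> \<rat>" for q
  proof -
    have "(\<Sum>k\<in>K. measure M {x \<in> cluster \<delta> k. g n x \<le> q}) = measure N {y \<in> \<Omega>'. y \<le> q}" for n
    proof -
      have [measurable]: "(\<lambda>y. y) \<in> borel_measurable N"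
        by (rule measurable_ident_restrict[OF sets_N])
      have "{y \<in> space N. y \<le> q} \<in> sets N"
        by measurable
      then have "measure (distr M N (g n)) {y \<in> \<Omega>'. y \<le> q} = measure M {x \<in> \<Omega>. g n x \<le> q}"
        using T_N g_in
        by (subst measure_distr) (auto simp: g_def space_N space_eq intro!: arg_cong[of _ _ "measure M"])
      then show ?thesis
        using T_distr measure_eq_sum_clusters[OF assms(1) K, of "\<lambda>x. g n x \<le> q"] by (simp add: g_def)
    qed
    moreover have "(\<lambda>n. \<Sum>k\<in>K. measure M {x \<in> cluster \<delta> k. g n x \<le> q}) \<longlonglongrightarrow> (\<Sum>k\<in>K. G k q)"
      by (intro tendsto_sum G q)
    ultimately show ?thesis
      using LIMSEQ_unique[OF _ tendsto_const] by simp
  qed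
  then show ?thesis
    using transport_map_of_relaxed_map[where G = G, OF assms(1-3) \<open>a \<le> b\<close> assms(4) K rel cdf] by blast
qed

section \<open>Existence of a transport map, and minimization of the cost\<close>

text \<open>The same construction with the constant envelopes \<open>Inf \<Omega>'\<close> and
  \<open>Sup \<Omega>'\<close>, whose difference as \<open>L\<close> imposes no restriction. It
  ensures that the infimum of the costs is taken over a nonempty set.\<close>

lemma transport_maps_nonempty:
  fixes a b :: real
  assumes "closed \<Omega>'" "\<Omega>' \<subseteq> {a..b}" "N \<in> prob_measures_on \<Omega>'"
  shows "transport_maps M N \<noteq> {}"
proof -
  interpret N: prob_space N
    using assms(3) by (simp add: prob_measures_on_def)
  have sets_N: "sets N = sets (restrict_space borel \<Omega>')"
    using assms(3) by (simp add: prob_measures_on_def)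
  have space_N: "space N = \<Omega>'"
    using sets_eq_imp_space_eq[OF sets_N] by (simp add: space_restrict_space)
  have ne: "\<Omega>' \<noteq> {}"
    using N.not_empty by (simp add: space_N)
  then obtain y where "y \<in> {a..b}"
    using assms(2) by blast
  then have "a \<le> b"
    by simp
  have bdd: "bdd_above \<Omega>'" "bdd_below \<Omega>'"
    using assms(2) by (meson bdd_above_Icc bdd_above_mono bdd_below_Icc bdd_below_mono)+
  define l where "l = Inf \<Omega>'"
  define h where "h = Sup \<Omega>'"
  have lh: "l \<in> \<Omega>'" "h \<in> \<Omega>'" "l \<le> h"
    using closed_contains_Inf[OF ne bdd(2) assms(1)] closed_contains_Sup[OF ne bdd(1) assms(1)]
      cInf_le_cSup[OF ne bdd] by (auto simp: l_def h_def)
  have between: "l \<le> y" "y \<le> h" if "y \<in> \<Omega>'" for y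
    using bdd that by (auto simp: l_def h_def intro: cInf_lower cSup_upper)
  define F where "F q = measure N {y \<in> \<Omega>'. y \<le> q}" for q
  have [measurable]: "(\<lambda>y. y) \<in> borel_measurable N"
    by (rule measurable_ident_restrict[OF sets_N])
  have sets_F: "{y \<in> \<Omega>'. y \<le> q} \<in> sets N" for q
    unfolding space_N[symmetric] by measurable
  have F: "0 \<le> F q" "F q \<le> 1" for q
    by (auto simp: F_def)
  have F_0: "F q = 0" if "q < l" for q
  proof -
    have "{y \<in> \<Omega>'. y \<le> q} = {}"
      using between that by force
    then show ?thesis
      unfolding F_def by (simp only: measure_empty)
  qed
  have F_1: "F q = 1" if "h \<le> q" for q
  proof -
    have "{y \<in> \<Omega>'. y \<le> q} = space N"
      using between that by (force simp: space_N)
    then show ?thesis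
      using N.prob_space by (simp add: F_def)
  qed
  \<comment> \<open>Each cluster of width 1 receives a share of the target law proportional to its
    own mass.\<close>
  define G where "G k q = measure M (cluster 1 k) * F q" for k q
  have rel: "relaxed_map \<Omega>' 1 (h - l) (\<lambda>_. l) (\<lambda>_. h)"
    using lh by (simp add: relaxed_map_def)
  have "F q \<le> F q'" if "q \<le> q'" for q q'
    unfolding F_def using that sets_F by (intro N.finite_measure_mono) auto
  moreover have "F t \<le> F s" if "{s<..t} \<inter> \<Omega>' = {}" for s t
  proof -
    have "{y \<in> \<Omega>'. y \<le> t} \<subseteq> {y \<in> \<Omega>'. y \<le> s}"
      using that by (force simp: not_le)
    then show ?thesis
      unfolding F_def using sets_F by (intro N.finite_measure_mono)
  qed
  moreover have "a \<le> l" "h \<le> b"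
    using lh assms(2) by auto
  moreover have "measure M (cluster 1 k) - G k q \<le> measure M {x \<in> cluster 1 k. q \<le> h}" for k q
    using F(1)[of q] F_1[of q] by (cases "q \<le> h") (auto simp: G_def)
  moreover have "G k q \<le> measure M {x \<in> cluster 1 k. l \<le> q}" for k q
    using F(2)[of q] F_0[of q] by (cases "l \<le> q") (auto simp: G_def mult_left_le)
  ultimately have cdf: "relaxed_cdf \<Omega>' a b (cluster 1 k) (\<lambda>_. l) (\<lambda>_. h) (G k)" for k
    using F F_0 F_1
    by (auto simp: relaxed_cdf_def G_def mult_left_le mult_left_mono not_le)
  obtain K where K: "finite K" "\<And>x. x \<in> \<Omega> \<Longrightarrow> \<lfloor>x / 1\<rfloor> \<in> K"
    using finite_clusters[of 1] by auto
  have "(\<Sum>k\<in>K. measure M (cluster 1 k)) = 1"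
    using measure_eq_sum_clusters[OF _ K, of "\<lambda>_. True"] prob_space by (simp add: space_eq)
  then have "(\<Sum>k\<in>K. G k q) = measure N {y \<in> \<Omega>'. y \<le> q}" for q
    by (simp add: G_def F_def flip: sum_distrib_right)
  then have "\<exists>T \<in> transport_maps M N. \<forall>x\<in>\<Omega>. \<forall>x'\<in>\<Omega>. \<bar>x - x'\<bar> < 1 \<longrightarrow> \<bar>T x - T x'\<bar> \<le> h - l"
    by (intro transport_map_of_relaxed_map[OF _ assms(1,2) \<open>a \<le> b\<close> assms(3) K rel cdf]) auto
  then show ?thesis
    by blast
qed

end

theorem theorem2:
  fixes \<delta> :: real and \<Omega> \<Omega>' :: "real set" and \<mu> \<nu> :: "real measure"
  assumes "\<delta> > 0"
    and "compact \<Omega>" and "compact \<Omega>'"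
    and "\<mu> \<in> prob_measures_on \<Omega>" and "\<nu> \<in> prob_measures_on \<Omega>'"
    and "measure_support \<mu> = \<Omega>" and "measure_support \<nu> = \<Omega>'"
    and "no_atom \<mu>"
  shows "\<exists>T \<in> transport_maps \<mu> \<nu>. \<forall>S \<in> transport_maps \<mu> \<nu>.
           modulus_cost \<Omega> \<delta> T \<le> modulus_cost \<Omega> \<delta> S"
proof -
  interpret atomless_on_line \<mu> \<Omega>
    using assms(2,4,8)
    by (auto simp: atomless_on_line_def atomless_on_line_axioms_def prob_measures_on_def
        compact_imp_bounded)
  have "closed \<Omega>'" "bounded \<Omega>'"
    using assms(3) by (auto intro: compact_imp_closed compact_imp_bounded)
  obtain B where "\<Omega>' \<subseteq> {-B..B}"
    using \<open>bounded \<Omega>'\<close> by (force simp: bounded_iff abs_le_iff)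
  note bounds = \<open>closed \<Omega>'\<close> \<open>\<Omega>' \<subseteq> {-B..B}\<close> assms(5)
  let ?D = "\<lambda>T::real \<Rightarrow> real. {\<bar>T x - T x'\<bar> | x x'. x \<in> \<Omega> \<and> x' \<in> \<Omega> \<and> \<bar>x - x'\<bar> < \<delta>}"
  have osc: "\<bar>T x - T x'\<bar> \<le> modulus_cost \<Omega> \<delta> T"
    if "T \<in> transport_maps \<mu> \<nu>" "x \<in> \<Omega>" "x' \<in> \<Omega>" "\<bar>x - x'\<bar> < \<delta>" for T x x'
    unfolding modulus_cost_def
    using modulus_cost_set_bdd_above[OF assms(4,5) \<open>bounded \<Omega>'\<close> that(1), of \<delta>] that
    by (intro cSup_upper) auto
  let ?C = "modulus_cost \<Omega> \<delta> ` transport_maps \<mu> \<nu>"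
  define L where "L = Inf ?C"
  have ne: "?C \<noteq> {}"
    using transport_maps_nonempty[OF bounds] by simp
  obtain x0 where "x0 \<in> \<Omega>"
    using not_empty by (auto simp: space_eq)
  \<comment> \<open>Taking both points equal to \<open>x0\<close> shows that every cost is
    nonnegative.\<close>
  have bdd: "bdd_below ?C"
    using osc[OF _ \<open>x0 \<in> \<Omega>\<close> \<open>x0 \<in> \<Omega>\<close>] assms(1) by (intro bdd_belowI[of _ 0]) auto
  \<comment> \<open>A minimizing sequence; its bounds converge to \<open>L\<close>, so
    \<open>limit_transport_map\<close> produces a map that attains the infimum.\<close>
  have "\<exists>T\<in>transport_maps \<mu> \<nu>. modulus_cost \<Omega> \<delta> T < L + inverse (real (Suc n))" for n
    using cInf_lessD[OF ne, of "L + inverse (real (Suc n))"] by (auto simp: L_def)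
  then obtain T where T: "\<And>n. T n \<in> transport_maps \<mu> \<nu>"
    "\<And>n. modulus_cost \<Omega> \<delta> (T n) < L + inverse (real (Suc n))"
    by metis
  have near: "\<bar>T n x - T n x'\<bar> \<le> L + inverse (real (Suc n))"
    if "x \<in> \<Omega>" "x' \<in> \<Omega>" "\<bar>x - x'\<bar> < \<delta>" for n x x'
    using osc[OF T(1) that, of n] T(2)[of n] by linarith
  have lim: "(\<lambda>n. L + inverse (real (Suc n))) \<longlonglongrightarrow> L"
    using tendsto_add[OF tendsto_const LIMSEQ_inverse_real_of_nat, of L] by simp
  obtain T' where T': "T' \<in> transport_maps \<mu> \<nu>"
    "\<And>x x'. x \<in> \<Omega> \<Longrightarrow> x' \<in> \<Omega> \<Longrightarrow> \<bar>x - x'\<bar> < \<delta> \<Longrightarrow> \<bar>T' x - T' x'\<bar> \<le> L"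
    using limit_transport_map[where T = T, OF assms(1) bounds T(1) near lim] by blast
  have "modulus_cost \<Omega> \<delta> T' \<le> L"
    unfolding modulus_cost_def
    using modulus_cost_set_nonempty[OF assms(4,1)] T'(2) by (intro cSup_least) auto
  also have "L \<le> modulus_cost \<Omega> \<delta> S" if "S \<in> transport_maps \<mu> \<nu>" for S
    unfolding L_def using bdd that by (intro cInf_lower) auto
  finally show ?thesis
    using T'(1) by blast
qed

end
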